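(* Let $\Lambda$ be a class of measurable functions such that for each $\lambda\in\Lambda$, $\lambda(X)$ is continuous with a density function (under $P$) bounded by $M>0$. Let $\beta_u(\cdot)$, $u\in[0,1]$, be a class of real functions that is uniformly bounded on $[0,1]$ and such that for each $u\in[0,1]$, $\beta_u(\cdot)$ is of bounded variation. Let $$\mathcal{B}_n\equiv\{\beta_u(G_{n,\lambda}(\lambda(\cdot);x_{(n)})):(u,\lambda,x_{(n)})\in[0,1]\times\Lambda\times\mathbf{R}^{nd_X}\}.$$ Then for any $q\ge1$, $$\log N_{[\cdot]}(C_2\varepsilon,\mathcal{B}_n,L_q(P))\le\log N(\varepsilon^q,\Lambda,\|\cdot\|_\infty)+C_1/\varepsilon,$$ where $C_1$ and $C_2$ are positive constants depending only on $q$ and $M$.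
   Context: $X$ is a random vector in $\mathbf{R}^{d_X}$ with distribution $P$, and $\Lambda$ consists of real-valued functions on $\mathbf{R}^{d_X}$. For $x_{(n)}\equiv(x_j)_{j=1}^n\in\mathbf{R}^{nd_X}$ (each $x_j\in\mathbf{R}^{d_X}$) and $\lambda\in\Lambda$, $G_{n,\lambda}(\cdot;x_{(n)})\equiv\frac1n\sum_{j=1}^n1\{\lambda(x_j)\le\cdot\}$. $\|\cdot\|_\infty$ is the sup norm. $N(\varepsilon,\mathcal{F},\|\cdot\|_\infty)$ is the $\varepsilon$-covering number of $\mathcal{F}$ with respect to $\|\cdot\|_\infty$ and $N_{[\cdot]}(\varepsilon,\mathcal{F},L_q(P))$ is the $\varepsilon$-bracketing number of $\mathcal{F}$ with respect to the $L_q(P)$-norm (van der Vaart–Wellner definitions). The inequality is for $\varepsilon>0$.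
   Formalization: As printed the claim is false (rescale constant β_u; or indicators of finite sets of rationals as n grows). Proved with the variations of β_u bounded by one V for all u, and with C_2 depending also on V and on the uniform bound K of the class; C_1 depends only on q and M. *)

theory Defs
  imports "HOL-Probability.Probability"
begin

text \<open>
  The space \<open>R\<^sup>d\<close> with its Borel sigma-algebra. Its points are the extensional functions on
  \<open>{..<d}\<close>; the dimension is a term and not a type, so that the constants in a theorem can be
  chosen uniformly in it.
\<close>

abbreviation euclid :: "nat \<Rightarrow> (nat \<Rightarrow> real) measure" where
  "euclid d \<equiv> PiM {..<d} (\<lambda>_. borel)"

definition sup_norm_on :: "'a set \<Rightarrow> ('a \<Rightarrow> real) \<Rightarrow> ennreal" where
  "sup_norm_on S f = (SUP x\<in>S. ennreal \<bar>f x\<bar>)"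

definition Lq_norm :: "'a measure \<Rightarrow> real \<Rightarrow> ('a \<Rightarrow> real) \<Rightarrow> ennreal" where
  "Lq_norm P q f =
     (let I = (\<integral>\<^sup>+ x. ennreal (\<bar>f x\<bar> powr q) \<partial>P)
      in if I = \<infinity> then \<infinity> else ennreal (enn2real I powr (1 / q)))"

text \<open>
  Covering and bracketing numbers in the sense of van der Vaart and Wellner: balls and brackets
  have radius resp. size strictly less than \<open>\<epsilon>\<close>; centres and bracket ends have finite norm
  but need not belong to the covered class. The infimum of the empty set is \<open>\<infinity>\<close>.
\<close>

definition covering_number ::
  "(('a \<Rightarrow> real) \<Rightarrow> ennreal) \<Rightarrow> real \<Rightarrow> ('a \<Rightarrow> real) set \<Rightarrow> enat" where
  "covering_number nrm \<epsilon> F = Inf {enat (card C) | C. finite C \<and> (\<forall>c\<in>C. nrm c < \<infinity>) \<and>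
     F \<subseteq> (\<Union>c\<in>C. {g. nrm (\<lambda>x. g x - c x) < ennreal \<epsilon>})}"

definition bracket :: "'a set \<Rightarrow> ('a \<Rightarrow> real) \<Rightarrow> ('a \<Rightarrow> real) \<Rightarrow> ('a \<Rightarrow> real) set" where
  "bracket S l u = {f. \<forall>x\<in>S. l x \<le> f x \<and> f x \<le> u x}"

definition bracketing_number ::
  "'a measure \<Rightarrow> real \<Rightarrow> real \<Rightarrow> ('a \<Rightarrow> real) set \<Rightarrow> enat" where
  "bracketing_number P q \<epsilon> F = Inf {enat (card A) | A. finite A \<and>
     (\<forall>(l, u)\<in>A. l \<in> borel_measurable P \<and> u \<in> borel_measurable P \<and>
        Lq_norm P q l < \<infinity> \<and> Lq_norm P q u < \<infinity> \<and>
        Lq_norm P q (\<lambda>x. u x - l x) < ennreal \<epsilon>) \<and>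
     F \<subseteq> (\<Union>(l, u)\<in>A. bracket (space P) l u)}"

definition log_enat :: "enat \<Rightarrow> ereal" where
  "log_enat N = (case N of enat n \<Rightarrow> if n = 0 then - \<infinity> else ereal (ln (real n)) | \<infinity> \<Rightarrow> \<infinity>)"

definition total_variation :: "real \<Rightarrow> real \<Rightarrow> (real \<Rightarrow> real) \<Rightarrow> ennreal" where
  "total_variation a b f =
     (SUP (n, t) \<in> {(n :: nat, t :: nat \<Rightarrow> real). mono_on {..n} t \<and> t ` {..n} \<subseteq> {a..b}}.
        ennreal (\<Sum>i<n. \<bar>f (t (Suc i)) - f (t i)\<bar>))"

definition has_density_bounded_by :: "'a measure \<Rightarrow> real \<Rightarrow> ('a \<Rightarrow> real) \<Rightarrow> bool" where
  "has_density_bounded_by P M lam \<longleftrightarrow>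
     (\<exists>p. distributed P lborel lam p \<and> (\<forall>t. p t \<le> ennreal M))"

definition emp_cdf :: "nat \<Rightarrow> ('a \<Rightarrow> real) \<Rightarrow> (nat \<Rightarrow> 'a) \<Rightarrow> real \<Rightarrow> real" where
  "emp_cdf n lam x t = (1 / real n) * (\<Sum>j=1..n. if lam (x j) \<le> t then 1 else 0)"

definition B_class ::
  "'a set \<Rightarrow> (real \<Rightarrow> real \<Rightarrow> real) \<Rightarrow> ('a \<Rightarrow> real) set \<Rightarrow> nat \<Rightarrow> ('a \<Rightarrow> real) set" where
  "B_class S \<beta> \<Lambda> n =
     {(\<lambda>y. \<beta> u (emp_cdf n lam x (lam y))) | u lam x.
        u \<in> {0..1} \<and> lam \<in> \<Lambda> \<and> (\<forall>j\<in>{1..n}. x j \<in> S)}"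

end

theory Submission
  imports Defs
begin

text \<open>
  By the Jordan decomposition, a member of the class is a difference of two functions
  \<open>h \<circ> \<lambda>\<close> with \<open>h\<close> nondecreasing and bounded. If \<open>\<lambda>\<close> is within \<open>\<delta> = 2\<epsilon>\<^sup>q\<close> of \<open>\<lambda>\<^sub>0\<close>, then
  \<open>h(\<lambda>\<^sub>0 - \<delta>) \<le> h \<circ> \<lambda> \<le> h(\<lambda>\<^sub>0 + \<delta>)\<close>, and the bounded density of \<open>\<lambda>\<^sub>0\<close> makes the \<open>q\<close>-th power of the
  \<open>L\<^sub>q\<close> distance of the two outer functions \<open>O(\<delta>)\<close>. It remains to bracket monotone functions of
  \<open>\<lambda>\<^sub>0\<close> with \<open>exp(O(1/\<epsilon>))\<close> brackets. After rounding \<open>h\<close> to multiples of \<open>1/m\<close>, \<open>m \<approx> 1/\<epsilon>\<close>, such a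
  function is a nondecreasing count from \<open>0\<close> to \<open>m\<close> on the levels of the cdf of \<open>\<lambda>\<^sub>0\<close>, and these
  are bracketed by repeatedly splitting a level interval into as many equal parts as the
  count increases by on it.
\<close>

section \<open>Bracketed classes\<close>

text \<open>The size is recorded as a bound \<open>e\<close> on the \<open>q\<close>-th power of the
  \<open>L_q\<close> norm over \<open>D\<close>, because this quantity adds up over disjoint pieces
  of the space. The bound \<open>B\<close> makes both ends \<open>L_q\<close>-finite under a
  probability measure.\<close>

definition small_bracket ::
  "'a measure \<Rightarrow> real \<Rightarrow> 'a set \<Rightarrow> real \<Rightarrow> ('a \<Rightarrow> real) \<Rightarrow> ('a \<Rightarrow> real) \<Rightarrow> bool" where
  "small_bracket P q D e l u \<longleftrightarrow> l \<in> borel_measurable P \<and> u \<in> borel_measurable P \<and>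
        (\<exists>B. \<forall>x. \<bar>l x\<bar> \<le> B \<and> \<bar>u x\<bar> \<le> B) \<and>
        (\<integral>\<^sup>+x\<in>D. ennreal (\<bar>u x - l x\<bar> powr q) \<partial>P) \<le> ennreal e"

definition bracketed ::
  "'a measure \<Rightarrow> real \<Rightarrow> 'a set \<Rightarrow> nat \<Rightarrow> real \<Rightarrow> ('a \<Rightarrow> real) set \<Rightarrow> bool" where
  "bracketed P q D N e \<F> \<longleftrightarrow> (\<exists>A. finite A \<and> card A \<le> N \<and>
     (\<forall>(l, u)\<in>A. small_bracket P q D e l u) \<and> \<F> \<subseteq> (\<Union>(l, u)\<in>A. bracket D l u))"

lemma bracketedE:
  assumes "bracketed P q D N e \<F>"
  obtains A where "finite A" "card A \<le> N"
    "\<forall>l u. (l, u) \<in> A \<longrightarrow> l \<in> borel_measurable P"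
    "\<forall>l u. (l, u) \<in> A \<longrightarrow> u \<in> borel_measurable P"
    "\<forall>l u. (l, u) \<in> A \<longrightarrow> (\<exists>B. \<forall>x. \<bar>l x\<bar> \<le> B \<and> \<bar>u x\<bar> \<le> B)"
    "\<forall>l u. (l, u) \<in> A \<longrightarrow> (\<integral>\<^sup>+x\<in>D. ennreal (\<bar>u x - l x\<bar> powr q) \<partial>P) \<le> ennreal e"
    "\<forall>f. f \<in> \<F> \<longrightarrow> (\<exists>l u. (l, u) \<in> A \<and> (\<forall>x\<in>D. l x \<le> f x \<and> f x \<le> u x))"
proof -
  obtain A where A: "finite A" "card A \<le> N"
     "\<forall>(l, u)\<in>A. small_bracket P q D e l u"
     "\<F> \<subseteq> (\<Union>(l, u)\<in>A. bracket D l u)"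
    using assms unfolding bracketed_def by blast
  show thesis
  proof (rule that[of A])
    show "\<forall>f. f \<in> \<F> \<longrightarrow> (\<exists>l u. (l, u) \<in> A \<and> (\<forall>x\<in>D. l x \<le> f x \<and> f x \<le> u x))"
      using A(4) by (fastforce simp: bracket_def)
  qed (use A in \<open>auto simp: small_bracket_def\<close>)
qed

lemma bracketedI:
  assumes "finite A" "card A \<le> N"
    "\<And>l u. (l, u) \<in> A \<Longrightarrow> l \<in> borel_measurable P"
    "\<And>l u. (l, u) \<in> A \<Longrightarrow> u \<in> borel_measurable P"
    "\<And>l u. (l, u) \<in> A \<Longrightarrow> \<exists>B. \<forall>x. \<bar>l x\<bar> \<le> B \<and> \<bar>u x\<bar> \<le> B"
    "\<And>l u. (l, u) \<in> A \<Longrightarrow> (\<integral>\<^sup>+x\<in>D. ennreal (\<bar>u x - l x\<bar> powr q) \<partial>P) \<le> ennreal e"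
    "\<And>f. f \<in> \<F> \<Longrightarrow> \<exists>l u. (l, u) \<in> A \<and> (\<forall>x\<in>D. l x \<le> f x \<and> f x \<le> u x)"
  shows "bracketed P q D N e \<F>"
  unfolding bracketed_def
proof (intro exI[of _ A] conjI)
  show "\<F> \<subseteq> (\<Union>(l, u)\<in>A. bracket D l u)"
    using assms(7) by (fastforce simp: bracket_def)
qed (use assms(1-6) in \<open>auto simp: small_bracket_def\<close>)

section \<open>Closure properties of bracketed classes\<close>

lemma bracketed_mono:
  assumes "bracketed P q D N e \<F>" "N \<le> N'" "e \<le> e'"
    and "\<And>f. f \<in> \<F>' \<Longrightarrow> \<exists>g\<in>\<F>. \<forall>x\<in>D. f x = g x"
  shows "bracketed P q D N' e' \<F>'"
proof -
  obtain A where A: "finite A" "card A \<le> N"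
    "\<forall>l u. (l, u) \<in> A \<longrightarrow> l \<in> borel_measurable P"
    "\<forall>l u. (l, u) \<in> A \<longrightarrow> u \<in> borel_measurable P"
    "\<forall>l u. (l, u) \<in> A \<longrightarrow> (\<exists>B. \<forall>x. \<bar>l x\<bar> \<le> B \<and> \<bar>u x\<bar> \<le> B)"
    "\<forall>l u. (l, u) \<in> A \<longrightarrow> (\<integral>\<^sup>+x\<in>D. ennreal (\<bar>u x - l x\<bar> powr q) \<partial>P) \<le> ennreal e"
    "\<forall>f. f \<in> \<F> \<longrightarrow> (\<exists>l u. (l, u) \<in> A \<and> (\<forall>x\<in>D. l x \<le> f x \<and> f x \<le> u x))"
    using assms(1) by (rule bracketedE) (rule that)
  show ?thesis
  proof (rule bracketedI[OF A(1) order.trans[OF A(2) assms(2)] A(3-5)[rule_format]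
        order.trans[OF A(6)[rule_format] ennreal_leI[OF assms(3)]]])
    fix f assume "f \<in> \<F>'"
    then obtain g where "g \<in> \<F>" "\<forall>x\<in>D. f x = g x" using assms(4) by blast
    with A(7) show "\<exists>l u. (l, u) \<in> A \<and> (\<forall>x\<in>D. l x \<le> f x \<and> f x \<le> u x)" by metis
  qed
qed

lemma bracketed_UN:
  assumes "finite I" "\<And>i. i \<in> I \<Longrightarrow> bracketed P q D (N i) e (\<F> i)"
  shows "bracketed P q D (\<Sum>i\<in>I. N i) e (\<Union>i\<in>I. \<F> i)"
proof -
  have "\<forall>i\<in>I. \<exists>A. finite A \<and> card A \<le> N i \<and>
     (\<forall>(l, u)\<in>A. small_bracket P q D e l u) \<and>
     \<F> i \<subseteq> (\<Union>(l, u)\<in>A. bracket D l u)"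
    using assms(2) unfolding bracketed_def by blast
  from bchoice[OF this] obtain A where A': "\<forall>i\<in>I. finite (A i) \<and> card (A i) \<le> N i \<and>
     (\<forall>(l, u)\<in>A i. small_bracket P q D e l u) \<and>
     \<F> i \<subseteq> (\<Union>(l, u)\<in>A i. bracket D l u)" ..
  note A = A'[rule_format, THEN conjunct1] A'[rule_format, THEN conjunct2, THEN conjunct1]
    A'[rule_format, THEN conjunct2, THEN conjunct2, THEN conjunct1]
    A'[rule_format, THEN conjunct2, THEN conjunct2, THEN conjunct2]
  have "card (\<Union>i\<in>I. A i) \<le> (\<Sum>i\<in>I. N i)"
    using card_UN_le[OF assms(1), of A] sum_mono[OF A(2), of I "\<lambda>i. i"] by simp
  moreover have "(\<Union>i\<in>I. \<F> i) \<subseteq> (\<Union>(l, u)\<in>(\<Union>i\<in>I. A i). bracket D l u)"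
    using A(4) by fastforce
  ultimately show ?thesis
    unfolding bracketed_def using A(1,3) assms(1)
    by (intro exI[of _ "\<Union>i\<in>I. A i"]) auto
qed

text \<open>Brackets on disjoint pieces are glued together: their numbers multiply, while the
  \<open>q\<close>-th powers of the sizes add without a constant factor, so gluing can be iterated
  any number of times.\<close>

lemma bracketed_split:
  assumes "bracketed P q D1 N1 e1 \<F>1" "bracketed P q D2 N2 e2 \<F>2"
    and [measurable]: "D1 \<in> sets P" "D2 \<in> sets P" and "D1 \<inter> D2 = {}" "e1 \<ge> 0" "e2 \<ge> 0"
  shows "bracketed P q (D1 \<union> D2) (N1 * N2) (e1 + e2) (\<F>1 \<inter> \<F>2)"
proof -
  obtain A where A: "finite A" "card A \<le> N1"
    "\<forall>l u. (l, u) \<in> A \<longrightarrow> l \<in> borel_measurable P"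
    "\<forall>l u. (l, u) \<in> A \<longrightarrow> u \<in> borel_measurable P"
    "\<forall>l u. (l, u) \<in> A \<longrightarrow> (\<exists>B. \<forall>x. \<bar>l x\<bar> \<le> B \<and> \<bar>u x\<bar> \<le> B)"
    "\<forall>l u. (l, u) \<in> A \<longrightarrow> (\<integral>\<^sup>+x\<in>D1. ennreal (\<bar>u x - l x\<bar> powr q) \<partial>P) \<le> ennreal e1"
    "\<forall>f. f \<in> \<F>1 \<longrightarrow> (\<exists>l u. (l, u) \<in> A \<and> (\<forall>x\<in>D1. l x \<le> f x \<and> f x \<le> u x))"
    using assms(1) by (rule bracketedE) (rule that)
  obtain A' where A': "finite A'" "card A' \<le> N2"
    "\<forall>l u. (l, u) \<in> A' \<longrightarrow> l \<in> borel_measurable P"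
    "\<forall>l u. (l, u) \<in> A' \<longrightarrow> u \<in> borel_measurable P"
    "\<forall>l u. (l, u) \<in> A' \<longrightarrow> (\<exists>B. \<forall>x. \<bar>l x\<bar> \<le> B \<and> \<bar>u x\<bar> \<le> B)"
    "\<forall>l u. (l, u) \<in> A' \<longrightarrow> (\<integral>\<^sup>+x\<in>D2. ennreal (\<bar>u x - l x\<bar> powr q) \<partial>P) \<le> ennreal e2"
    "\<forall>f. f \<in> \<F>2 \<longrightarrow> (\<exists>l u. (l, u) \<in> A' \<and> (\<forall>x\<in>D2. l x \<le> f x \<and> f x \<le> u x))"
    using assms(2) by (rule bracketedE) (rule that)
  define \<Phi> :: "(('a \<Rightarrow> real) \<times> ('a \<Rightarrow> real)) \<times> (('a \<Rightarrow> real) \<times> ('a \<Rightarrow> real)) \<Rightarrow> ('a \<Rightarrow> real) \<times> ('a \<Rightarrow> real)" where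
    "\<Phi> = (\<lambda>((l1, u1), (l2, u2)).
       (\<lambda>x. if x \<in> D1 then l1 x else l2 x, \<lambda>x. if x \<in> D1 then u1 x else u2 x))"
  show ?thesis
  proof (rule bracketedI[of "\<Phi> ` (A \<times> A')"])
    show "card (\<Phi> ` (A \<times> A')) \<le> N1 * N2"
      using order.trans[OF card_image_le[of "A \<times> A'" \<Phi>]] A(1) A'(1) mult_le_mono[OF A(2) A'(2)]
      by (simp add: card_cartesian_product)
  next
    fix l u assume "(l, u) \<in> \<Phi> ` (A \<times> A')"
    then obtain l1 u1 l2 u2 where *: "(l1, u1) \<in> A" "(l2, u2) \<in> A'"
      "l = (\<lambda>x. if x \<in> D1 then l1 x else l2 x)" "u = (\<lambda>x. if x \<in> D1 then u1 x else u2 x)"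
      by (auto simp: \<Phi>_def)
    note [measurable] = A(3,4)[rule_format, OF *(1)] A'(3,4)[rule_format, OF *(2)]
    show "l \<in> borel_measurable P" "u \<in> borel_measurable P"
      by (auto simp: *(3,4))
    obtain B1 B2 where "\<And>x. \<bar>l1 x\<bar> \<le> B1 \<and> \<bar>u1 x\<bar> \<le> B1" "\<And>x. \<bar>l2 x\<bar> \<le> B2 \<and> \<bar>u2 x\<bar> \<le> B2"
      using A(5)[rule_format, OF *(1)] A'(5)[rule_format, OF *(2)] by auto
    then show "\<exists>B. \<forall>x. \<bar>l x\<bar> \<le> B \<and> \<bar>u x\<bar> \<le> B"
      by (intro exI[of _ "max B1 B2"]) (auto simp: *(3,4) le_max_iff_disj)
    have "(\<integral>\<^sup>+x\<in>D1 \<union> D2. ennreal (\<bar>u x - l x\<bar> powr q) \<partial>P) =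
       (\<integral>\<^sup>+x. (ennreal (\<bar>u1 x - l1 x\<bar> powr q) * indicator D1 x + ennreal (\<bar>u2 x - l2 x\<bar> powr q) * indicator D2 x) \<partial>P)"
      using assms(5) by (intro nn_integral_cong) (auto simp: *(3,4) indicator_def)
    also have "\<dots> = (\<integral>\<^sup>+x\<in>D1. ennreal (\<bar>u1 x - l1 x\<bar> powr q) \<partial>P) + (\<integral>\<^sup>+x\<in>D2. ennreal (\<bar>u2 x - l2 x\<bar> powr q) \<partial>P)"
      by (rule nn_integral_add) auto
    also have "\<dots> \<le> ennreal e1 + ennreal e2"
      using A(6)[rule_format, OF *(1)] A'(6)[rule_format, OF *(2)] by (rule add_mono)
    finally show "(\<integral>\<^sup>+x\<in>D1 \<union> D2. ennreal (\<bar>u x - l x\<bar> powr q) \<partial>P) \<le> ennreal (e1 + e2)"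
      using assms(6,7) by (simp add: ennreal_plus)
  next
    fix f assume f: "f \<in> \<F>1 \<inter> \<F>2"
    obtain l1 u1 where 1: "(l1, u1) \<in> A" "\<forall>x\<in>D1. l1 x \<le> f x \<and> f x \<le> u1 x" using A(7)[rule_format, of f] f by blast
    obtain l2 u2 where 2: "(l2, u2) \<in> A'" "\<forall>x\<in>D2. l2 x \<le> f x \<and> f x \<le> u2 x" using A'(7)[rule_format, of f] f by blast
    have "\<Phi> ((l1, u1), (l2, u2)) \<in> \<Phi> ` (A \<times> A')" using 1 2 by blast
    then show "\<exists>l u. (l, u) \<in> \<Phi> ` (A \<times> A') \<and> (\<forall>x\<in>D1 \<union> D2. l x \<le> f x \<and> f x \<le> u x)"
      using 1 2 assms(5) unfolding \<Phi>_def by (intro exI conjI) auto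
  qed (use A(1) A'(1) in auto)
qed

lemma bracketed_affine:
  assumes "bracketed P q D N e \<F>" and [measurable]: "D \<in> sets P" and "c \<ge> 0" "e \<ge> 0"
  shows "bracketed P q D N (c powr q * e) ((\<lambda>f x. b + c * f x) ` \<F>)"
proof -
  obtain A where A: "finite A" "card A \<le> N"
    "\<forall>l u. (l, u) \<in> A \<longrightarrow> l \<in> borel_measurable P"
    "\<forall>l u. (l, u) \<in> A \<longrightarrow> u \<in> borel_measurable P"
    "\<forall>l u. (l, u) \<in> A \<longrightarrow> (\<exists>B. \<forall>x. \<bar>l x\<bar> \<le> B \<and> \<bar>u x\<bar> \<le> B)"
    "\<forall>l u. (l, u) \<in> A \<longrightarrow> (\<integral>\<^sup>+x\<in>D. ennreal (\<bar>u x - l x\<bar> powr q) \<partial>P) \<le> ennreal e"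
    "\<forall>f. f \<in> \<F> \<longrightarrow> (\<exists>l u. (l, u) \<in> A \<and> (\<forall>x\<in>D. l x \<le> f x \<and> f x \<le> u x))"
    using assms(1) by (rule bracketedE) (rule that)
  define \<Phi> :: "('a \<Rightarrow> real) \<times> ('a \<Rightarrow> real) \<Rightarrow> ('a \<Rightarrow> real) \<times> ('a \<Rightarrow> real)" where
    "\<Phi> = (\<lambda>(l, u). (\<lambda>x. b + c * l x, \<lambda>x. b + c * u x))"
  show ?thesis
  proof (rule bracketedI[of "\<Phi> ` A"])
    show "card (\<Phi> ` A) \<le> N"
      using card_image_le[of A \<Phi>] A(1,2) by simp
  next
    fix l' u' assume "(l', u') \<in> \<Phi> ` A"
    then obtain l u where *: "(l, u) \<in> A" "l' = (\<lambda>x. b + c * l x)" "u' = (\<lambda>x. b + c * u x)"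
      by (auto simp: \<Phi>_def)
    note [measurable] = A(3,4)[rule_format, OF *(1)]
    show "l' \<in> borel_measurable P" "u' \<in> borel_measurable P"
      by (auto simp: *(2,3))
    obtain B where B: "\<And>x. \<bar>l x\<bar> \<le> B \<and> \<bar>u x\<bar> \<le> B"
      using A(5)[rule_format, OF *(1)] by auto
    have "\<bar>b + c * y\<bar> \<le> \<bar>b\<bar> + c * B" if "\<bar>y\<bar> \<le> B" for y
      using abs_triangle_ineq[of b "c * y"] mult_left_mono[OF that \<open>c \<ge> 0\<close>] \<open>c \<ge> 0\<close>
      by (simp add: abs_mult)
    with B show "\<exists>B. \<forall>x. \<bar>l' x\<bar> \<le> B \<and> \<bar>u' x\<bar> \<le> B"
      by (auto simp: *(2,3) intro!: exI[of _ "\<bar>b\<bar> + c * B"])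
    have "\<bar>u' x - l' x\<bar> powr q = c powr q * \<bar>u x - l x\<bar> powr q" for x
    proof -
      have "u' x - l' x = c * (u x - l x)" by (simp add: *(2,3) algebra_simps)
      then show ?thesis using \<open>c \<ge> 0\<close> by (simp add: abs_mult powr_mult)
    qed
    then have "(\<integral>\<^sup>+x\<in>D. ennreal (\<bar>u' x - l' x\<bar> powr q) \<partial>P) =
        (\<integral>\<^sup>+x. ennreal (c powr q) * (ennreal (\<bar>u x - l x\<bar> powr q) * indicator D x) \<partial>P)"
      by (simp add: ennreal_mult mult.assoc)
    also have "\<dots> = ennreal (c powr q) * (\<integral>\<^sup>+x\<in>D. ennreal (\<bar>u x - l x\<bar> powr q) \<partial>P)"
      by (rule nn_integral_cmult) simp
    also have "\<dots> \<le> ennreal (c powr q) * ennreal e"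
      using A(6)[rule_format, OF *(1)] by (rule mult_left_mono) simp
    finally show "(\<integral>\<^sup>+x\<in>D. ennreal (\<bar>u' x - l' x\<bar> powr q) \<partial>P) \<le> ennreal (c powr q * e)"
      using \<open>e \<ge> 0\<close> by (simp add: ennreal_mult)
  next
    fix f' assume "f' \<in> (\<lambda>f x. b + c * f x) ` \<F>"
    then obtain f where f: "f \<in> \<F>" "f' = (\<lambda>x. b + c * f x)" by auto
    obtain l u where 1: "(l, u) \<in> A" "\<forall>x\<in>D. l x \<le> f x \<and> f x \<le> u x" using A(7)[rule_format, OF f(1)] by blast
    have "\<Phi> (l, u) \<in> \<Phi> ` A" using 1 by blast
    then have "(\<lambda>x. b + c * l x, \<lambda>x. b + c * u x) \<in> \<Phi> ` A" by (simp add: \<Phi>_def)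
    moreover have "\<forall>x\<in>D. b + c * l x \<le> f' x \<and> f' x \<le> b + c * u x"
      using 1(2) \<open>c \<ge> 0\<close> by (auto simp: f(2) intro!: mult_left_mono)
    ultimately show "\<exists>l u. (l, u) \<in> \<Phi> ` A \<and> (\<forall>x\<in>D. l x \<le> f' x \<and> f' x \<le> u x)"
      by blast
  qed (use A(1) in auto)
qed

text \<open>The sum is at most three times its largest term. This takes the place of Minkowski's
  inequality; the loss \<open>3 powr q\<close> depends on \<open>q\<close> alone.\<close>

lemma powr_sum3_le:
  fixes a b c q :: real
  assumes "a \<ge> 0" "b \<ge> 0" "c \<ge> 0" "q \<ge> 0"
  shows "(a + b + c) powr q \<le> 3 powr q * (a powr q + b powr q + c powr q)"
proof -
  define d where "d = max a (max b c)"
  have "(a + b + c) powr q \<le> (3 * d) powr q"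
    using assms by (intro powr_mono2) (auto simp: d_def)
  also have "\<dots> = 3 powr q * d powr q"
    using assms by (simp add: powr_mult d_def)
  also have "d powr q \<le> a powr q + b powr q + c powr q"
    by (auto simp: d_def max_def)
  finally show ?thesis by simp
qed

text \<open>The new bracket takes its lower end from a bracket around \<open>f1\<close> and its
  upper end from a bracket around \<open>f2\<close>. Its width is at most the widths of these two
  brackets plus the gap \<open>f2 - f1\<close>.\<close>

lemma bracketed_sandwich:
  assumes "bracketed P q D N1 e1 \<F>1" "bracketed P q D N2 e2 \<F>2"
    and [measurable]: "D \<in> sets P" and "e1 \<ge> 0" "e2 \<ge> 0" "e3 \<ge> 0" "q \<ge> 0"
    and \<F>: "\<And>f. f \<in> \<F> \<Longrightarrow> \<exists>f1\<in>\<F>1. \<exists>f2\<in>\<F>2.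
      (\<forall>x\<in>D. f1 x \<le> f x \<and> f x \<le> f2 x) \<and> f1 \<in> borel_measurable P \<and> f2 \<in> borel_measurable P \<and>
      (\<integral>\<^sup>+x\<in>D. ennreal (\<bar>f2 x - f1 x\<bar> powr q) \<partial>P) \<le> ennreal e3"
  shows "bracketed P q D (N1 * N2) (3 powr q * (e1 + e2 + e3)) \<F>"
proof -
  obtain A where A: "finite A" "card A \<le> N1"
    "\<forall>l u. (l, u) \<in> A \<longrightarrow> l \<in> borel_measurable P"
    "\<forall>l u. (l, u) \<in> A \<longrightarrow> u \<in> borel_measurable P"
    "\<forall>l u. (l, u) \<in> A \<longrightarrow> (\<exists>B. \<forall>x. \<bar>l x\<bar> \<le> B \<and> \<bar>u x\<bar> \<le> B)"
    "\<forall>l u. (l, u) \<in> A \<longrightarrow> (\<integral>\<^sup>+x\<in>D. ennreal (\<bar>u x - l x\<bar> powr q) \<partial>P) \<le> ennreal e1"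
    "\<forall>f. f \<in> \<F>1 \<longrightarrow> (\<exists>l u. (l, u) \<in> A \<and> (\<forall>x\<in>D. l x \<le> f x \<and> f x \<le> u x))"
    using assms(1) by (rule bracketedE) (rule that)
  obtain A' where A': "finite A'" "card A' \<le> N2"
    "\<forall>l u. (l, u) \<in> A' \<longrightarrow> l \<in> borel_measurable P"
    "\<forall>l u. (l, u) \<in> A' \<longrightarrow> u \<in> borel_measurable P"
    "\<forall>l u. (l, u) \<in> A' \<longrightarrow> (\<exists>B. \<forall>x. \<bar>l x\<bar> \<le> B \<and> \<bar>u x\<bar> \<le> B)"
    "\<forall>l u. (l, u) \<in> A' \<longrightarrow> (\<integral>\<^sup>+x\<in>D. ennreal (\<bar>u x - l x\<bar> powr q) \<partial>P) \<le> ennreal e2"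
    "\<forall>f. f \<in> \<F>2 \<longrightarrow> (\<exists>l u. (l, u) \<in> A' \<and> (\<forall>x\<in>D. l x \<le> f x \<and> f x \<le> u x))"
    using assms(2) by (rule bracketedE) (rule that)
  define \<Phi> :: "(('a \<Rightarrow> real) \<times> ('a \<Rightarrow> real)) \<times> (('a \<Rightarrow> real) \<times> ('a \<Rightarrow> real)) \<Rightarrow> ('a \<Rightarrow> real) \<times> ('a \<Rightarrow> real)" where
    "\<Phi> = (\<lambda>((l1, u1), (l2, u2)). (l1, u2))"
  \<comment> \<open>An arbitrary pair of brackets need not be close together. Only pairs containing
    some \<open>f1\<close> and \<open>f2\<close> with a small gap are kept, and these witnesses
    control \<open>u2 - l1\<close>.\<close>
  define R where "R = {((l1, u1), (l2, u2)) | l1 u1 l2 u2. (l1, u1) \<in> A \<and> (l2, u2) \<in> A' \<and>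
     (\<exists>f1 f2. (\<forall>x\<in>D. l1 x \<le> f1 x \<and> f1 x \<le> u1 x \<and> l2 x \<le> f2 x \<and> f2 x \<le> u2 x \<and> f1 x \<le> f2 x) \<and>
       f1 \<in> borel_measurable P \<and> f2 \<in> borel_measurable P \<and>
      (\<integral>\<^sup>+x\<in>D. ennreal (\<bar>f2 x - f1 x\<bar> powr q) \<partial>P) \<le> ennreal e3)}"
  have RA: "R \<subseteq> A \<times> A'" by (auto simp: R_def)
  then have finR: "finite R" using A(1) A'(1) finite_subset by blast
  have "card R \<le> N1 * N2"
    using order.trans[OF card_mono[OF _ RA]] A(1) A'(1) mult_le_mono[OF A(2) A'(2)]
    by (simp add: card_cartesian_product)
  then have cardR: "card (\<Phi> ` R) \<le> N1 * N2"
    using card_image_le[OF finR, of \<Phi>] by simp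
  show ?thesis
  proof (rule bracketedI[OF _ cardR])
    fix l u assume "(l, u) \<in> \<Phi> ` R"
    then obtain u1 l2 f1 f2 where *: "(l, u1) \<in> A" "(l2, u) \<in> A'"
      "\<forall>x\<in>D. l x \<le> f1 x \<and> f1 x \<le> u1 x \<and> l2 x \<le> f2 x \<and> f2 x \<le> u x \<and> f1 x \<le> f2 x"
      "f1 \<in> borel_measurable P" "f2 \<in> borel_measurable P"
      "(\<integral>\<^sup>+x\<in>D. ennreal (\<bar>f2 x - f1 x\<bar> powr q) \<partial>P) \<le> ennreal e3"
      by (auto simp: \<Phi>_def R_def)
    note [measurable] = A(3,4)[rule_format, OF *(1)] A'(3,4)[rule_format, OF *(2)] *(4,5)
    show "l \<in> borel_measurable P" "u \<in> borel_measurable P" by auto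
    obtain B1 B2 where "\<And>x. \<bar>l x\<bar> \<le> B1 \<and> \<bar>u1 x\<bar> \<le> B1" "\<And>x. \<bar>l2 x\<bar> \<le> B2 \<and> \<bar>u x\<bar> \<le> B2"
      using A(5)[rule_format, OF *(1)] A'(5)[rule_format, OF *(2)] by auto
    then show "\<exists>B. \<forall>x. \<bar>l x\<bar> \<le> B \<and> \<bar>u x\<bar> \<le> B"
      by (intro exI[of _ "max B1 B2"]) (auto simp: le_max_iff_disj)
    have pw: "\<bar>u x - l x\<bar> powr q \<le> 3 powr q * (\<bar>u1 x - l x\<bar> powr q + \<bar>u x - l2 x\<bar> powr q + \<bar>f2 x - f1 x\<bar> powr q)"
      if "x \<in> D" for x
    proof -
      \<comment> \<open>Here \<open>u - l = (u1 - l) + (u - l2) + (l2 - u1)\<close>, and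
        \<open>l2 - u1 \<le> f2 - f1\<close> because \<open>l2 \<le> f2\<close> and
        \<open>f1 \<le> u1\<close>.\<close>
      have "\<bar>u x - l x\<bar> powr q \<le> (\<bar>u1 x - l x\<bar> + \<bar>u x - l2 x\<bar> + \<bar>f2 x - f1 x\<bar>) powr q"
        using *(3) that \<open>q \<ge> 0\<close> by (intro powr_mono2) fastforce+
      also have "\<dots> \<le> 3 powr q * (\<bar>u1 x - l x\<bar> powr q + \<bar>u x - l2 x\<bar> powr q + \<bar>f2 x - f1 x\<bar> powr q)"
        using \<open>q \<ge> 0\<close> by (intro powr_sum3_le) auto
      finally show ?thesis .
    qed
    have "(\<integral>\<^sup>+x\<in>D. ennreal (\<bar>u x - l x\<bar> powr q) \<partial>P) \<le>
       (\<integral>\<^sup>+x. ennreal (3 powr q) * (ennreal (\<bar>u1 x - l x\<bar> powr q) * indicator D x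
          + ennreal (\<bar>u x - l2 x\<bar> powr q) * indicator D x
          + ennreal (\<bar>f2 x - f1 x\<bar> powr q) * indicator D x) \<partial>P)"
      using pw by (intro nn_integral_mono)
        (auto simp: indicator_def ennreal_plus[symmetric] ennreal_mult[symmetric]
          simp del: ennreal_plus intro!: ennreal_leI)
    also have "\<dots> = ennreal (3 powr q) * ((\<integral>\<^sup>+x\<in>D. ennreal (\<bar>u1 x - l x\<bar> powr q) \<partial>P)
         + (\<integral>\<^sup>+x\<in>D. ennreal (\<bar>u x - l2 x\<bar> powr q) \<partial>P) + (\<integral>\<^sup>+x\<in>D. ennreal (\<bar>f2 x - f1 x\<bar> powr q) \<partial>P))"
      by (simp add: nn_integral_cmult nn_integral_add)
    also have "\<dots> \<le> ennreal (3 powr q) * (ennreal e1 + ennreal e2 + ennreal e3)"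
      using A(6)[rule_format, OF *(1)] A'(6)[rule_format, OF *(2)] *(6) by (intro mult_left_mono add_mono) auto
    finally show "(\<integral>\<^sup>+x\<in>D. ennreal (\<bar>u x - l x\<bar> powr q) \<partial>P) \<le> ennreal (3 powr q * (e1 + e2 + e3))"
      using assms(4-6) by (simp add: ennreal_plus ennreal_mult)
  next
    fix f assume "f \<in> \<F>"
    then obtain f1 f2 where f: "f1 \<in> \<F>1" "f2 \<in> \<F>2"
      "\<forall>x\<in>D. f1 x \<le> f x \<and> f x \<le> f2 x" "f1 \<in> borel_measurable P" "f2 \<in> borel_measurable P"
      "(\<integral>\<^sup>+x\<in>D. ennreal (\<bar>f2 x - f1 x\<bar> powr q) \<partial>P) \<le> ennreal e3"
      using \<F> by blast
    obtain l1 u1 where 1: "(l1, u1) \<in> A" "\<forall>x\<in>D. l1 x \<le> f1 x \<and> f1 x \<le> u1 x" using A(7)[rule_format, OF f(1)] by blast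
    obtain l2 u2 where 2: "(l2, u2) \<in> A'" "\<forall>x\<in>D. l2 x \<le> f2 x \<and> f2 x \<le> u2 x" using A'(7)[rule_format, OF f(2)] by blast
    have "\<forall>x\<in>D. l1 x \<le> f1 x \<and> f1 x \<le> u1 x \<and> l2 x \<le> f2 x \<and> f2 x \<le> u2 x \<and> f1 x \<le> f2 x"
      using 1(2) 2(2) f(3) order_trans[of "f1 _" "f _" "f2 _"] by blast
    then have "((l1, u1), (l2, u2)) \<in> R"
      unfolding R_def using 1(1) 2(1) f(4-6) by blast
    then have "\<Phi> ((l1, u1), (l2, u2)) \<in> \<Phi> ` R" by blast
    then have "(l1, u2) \<in> \<Phi> ` R" by (simp add: \<Phi>_def)
    moreover have "\<forall>x\<in>D. l1 x \<le> f x \<and> f x \<le> u2 x"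
      using 1(2) 2(2) f(3) order_trans by meson
    ultimately show "\<exists>l u. (l, u) \<in> \<Phi> ` R \<and> (\<forall>x\<in>D. l x \<le> f x \<and> f x \<le> u x)"
      by blast
  qed (use finR in auto)
qed

lemma bracketed_diff:
  assumes "bracketed P q D N1 e1 \<F>1" "bracketed P q D N2 e2 \<F>2"
    and [measurable]: "D \<in> sets P" and "e1 \<ge> 0" "e2 \<ge> 0" "q \<ge> 0"
  shows "bracketed P q D (N1 * N2) (3 powr q * (e1 + e2)) {\<lambda>x. f x - g x | f g. f \<in> \<F>1 \<and> g \<in> \<F>2}"
proof -
  obtain A where A: "finite A" "card A \<le> N1"
    "\<forall>l u. (l, u) \<in> A \<longrightarrow> l \<in> borel_measurable P"
    "\<forall>l u. (l, u) \<in> A \<longrightarrow> u \<in> borel_measurable P"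
    "\<forall>l u. (l, u) \<in> A \<longrightarrow> (\<exists>B. \<forall>x. \<bar>l x\<bar> \<le> B \<and> \<bar>u x\<bar> \<le> B)"
    "\<forall>l u. (l, u) \<in> A \<longrightarrow> (\<integral>\<^sup>+x\<in>D. ennreal (\<bar>u x - l x\<bar> powr q) \<partial>P) \<le> ennreal e1"
    "\<forall>f. f \<in> \<F>1 \<longrightarrow> (\<exists>l u. (l, u) \<in> A \<and> (\<forall>x\<in>D. l x \<le> f x \<and> f x \<le> u x))"
    using assms(1) by (rule bracketedE) (rule that)
  obtain A' where A': "finite A'" "card A' \<le> N2"
    "\<forall>l u. (l, u) \<in> A' \<longrightarrow> l \<in> borel_measurable P"
    "\<forall>l u. (l, u) \<in> A' \<longrightarrow> u \<in> borel_measurable P"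
    "\<forall>l u. (l, u) \<in> A' \<longrightarrow> (\<exists>B. \<forall>x. \<bar>l x\<bar> \<le> B \<and> \<bar>u x\<bar> \<le> B)"
    "\<forall>l u. (l, u) \<in> A' \<longrightarrow> (\<integral>\<^sup>+x\<in>D. ennreal (\<bar>u x - l x\<bar> powr q) \<partial>P) \<le> ennreal e2"
    "\<forall>f. f \<in> \<F>2 \<longrightarrow> (\<exists>l u. (l, u) \<in> A' \<and> (\<forall>x\<in>D. l x \<le> f x \<and> f x \<le> u x))"
    using assms(2) by (rule bracketedE) (rule that)
  define \<Phi> :: "(('a \<Rightarrow> real) \<times> ('a \<Rightarrow> real)) \<times> (('a \<Rightarrow> real) \<times> ('a \<Rightarrow> real)) \<Rightarrow> ('a \<Rightarrow> real) \<times> ('a \<Rightarrow> real)" where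
    "\<Phi> = (\<lambda>((l1, u1), (l2, u2)). (\<lambda>x. l1 x - u2 x, \<lambda>x. u1 x - l2 x))"
  show ?thesis
  proof (rule bracketedI[of "\<Phi> ` (A \<times> A')"])
    show "card (\<Phi> ` (A \<times> A')) \<le> N1 * N2"
      using order.trans[OF card_image_le[of "A \<times> A'" \<Phi>]] A(1) A'(1) mult_le_mono[OF A(2) A'(2)]
      by (simp add: card_cartesian_product)
  next
    fix l u assume "(l, u) \<in> \<Phi> ` (A \<times> A')"
    then obtain l1 u1 l2 u2 where *: "(l1, u1) \<in> A" "(l2, u2) \<in> A'"
      "l = (\<lambda>x. l1 x - u2 x)" "u = (\<lambda>x. u1 x - l2 x)"
      by (auto simp: \<Phi>_def)
    note [measurable] = A(3,4)[rule_format, OF *(1)] A'(3,4)[rule_format, OF *(2)]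
    show "l \<in> borel_measurable P" "u \<in> borel_measurable P"
      by (auto simp: *(3,4))
    obtain B1 B2 where "\<And>x. \<bar>l1 x\<bar> \<le> B1 \<and> \<bar>u1 x\<bar> \<le> B1" "\<And>x. \<bar>l2 x\<bar> \<le> B2 \<and> \<bar>u2 x\<bar> \<le> B2"
      using A(5)[rule_format, OF *(1)] A'(5)[rule_format, OF *(2)] by auto
    then show "\<exists>B. \<forall>x. \<bar>l x\<bar> \<le> B \<and> \<bar>u x\<bar> \<le> B"
      unfolding *(3,4)
      by (intro exI[of _ "B1 + B2"] allI conjI order.trans[OF abs_triangle_ineq4 add_mono]) auto
    have pw: "\<bar>u x - l x\<bar> powr q \<le> 3 powr q * (\<bar>u1 x - l1 x\<bar> powr q + \<bar>u2 x - l2 x\<bar> powr q)" for x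
    proof -
      \<comment> \<open>The width is the sum of the two widths; the zero pads it to the three-term
        inequality.\<close>
      have "\<bar>u x - l x\<bar> powr q \<le> (\<bar>u1 x - l1 x\<bar> + \<bar>u2 x - l2 x\<bar> + 0) powr q"
        using \<open>q \<ge> 0\<close> unfolding *(3,4) by (intro powr_mono2) auto
      also have "\<dots> \<le> 3 powr q * (\<bar>u1 x - l1 x\<bar> powr q + \<bar>u2 x - l2 x\<bar> powr q + 0 powr q)"
        using \<open>q \<ge> 0\<close> by (intro powr_sum3_le) auto
      finally show ?thesis by simp
    qed
    have "(\<integral>\<^sup>+x\<in>D. ennreal (\<bar>u x - l x\<bar> powr q) \<partial>P) \<le>
       (\<integral>\<^sup>+x. ennreal (3 powr q) * (ennreal (\<bar>u1 x - l1 x\<bar> powr q) * indicator D x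
          + ennreal (\<bar>u2 x - l2 x\<bar> powr q) * indicator D x) \<partial>P)"
      using pw by (intro nn_integral_mono)
        (auto simp: indicator_def ennreal_plus[symmetric] ennreal_mult[symmetric]
          simp del: ennreal_plus intro!: ennreal_leI)
    also have "\<dots> = ennreal (3 powr q) * ((\<integral>\<^sup>+x\<in>D. ennreal (\<bar>u1 x - l1 x\<bar> powr q) \<partial>P)
         + (\<integral>\<^sup>+x\<in>D. ennreal (\<bar>u2 x - l2 x\<bar> powr q) \<partial>P))"
      by (simp add: nn_integral_cmult nn_integral_add)
    also have "\<dots> \<le> ennreal (3 powr q) * (ennreal e1 + ennreal e2)"
      using A(6)[rule_format, OF *(1)] A'(6)[rule_format, OF *(2)] by (intro mult_left_mono add_mono) auto
    finally show "(\<integral>\<^sup>+x\<in>D. ennreal (\<bar>u x - l x\<bar> powr q) \<partial>P) \<le> ennreal (3 powr q * (e1 + e2))"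
      using assms(4,5) by (simp add: ennreal_plus ennreal_mult)
  next
    fix h assume "h \<in> {\<lambda>x. f x - g x | f g. f \<in> \<F>1 \<and> g \<in> \<F>2}"
    then obtain f g where h: "h = (\<lambda>x. f x - g x)" "f \<in> \<F>1" "g \<in> \<F>2" by auto
    obtain l1 u1 where 1: "(l1, u1) \<in> A" "\<forall>x\<in>D. l1 x \<le> f x \<and> f x \<le> u1 x" using A(7)[rule_format, OF h(2)] by blast
    obtain l2 u2 where 2: "(l2, u2) \<in> A'" "\<forall>x\<in>D. l2 x \<le> g x \<and> g x \<le> u2 x" using A'(7)[rule_format, OF h(3)] by blast
    have "\<Phi> ((l1, u1), (l2, u2)) \<in> \<Phi> ` (A \<times> A')" using 1 2 by blast
    then have "(\<lambda>x. l1 x - u2 x, \<lambda>x. u1 x - l2 x) \<in> \<Phi> ` (A \<times> A')" by (simp add: \<Phi>_def)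
    moreover have "\<forall>x\<in>D. l1 x - u2 x \<le> h x \<and> h x \<le> u1 x - l2 x"
      using 1(2) 2(2) unfolding h by (simp add: diff_mono)
    ultimately show "\<exists>l u. (l, u) \<in> \<Phi> ` (A \<times> A') \<and> (\<forall>x\<in>D. l x \<le> h x \<and> h x \<le> u x)"
      by blast
  qed (use A(1) A'(1) in auto)
qed

section \<open>From integrals of \<open>q\<close>-th powers to bracketing numbers\<close>

lemma Lq_norm_le:
  assumes "(\<integral>\<^sup>+x. ennreal (\<bar>f x\<bar> powr q) \<partial>P) \<le> ennreal e" "q > 0" "e \<ge> 0"
  shows "Lq_norm P q f \<le> ennreal (e powr (1 / q))"
proof -
  define I where "I = (\<integral>\<^sup>+x. ennreal (\<bar>f x\<bar> powr q) \<partial>P)"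
  have "I < \<infinity>" using assms(1) unfolding I_def[symmetric]
    by (metis ennreal_less_top infinity_ennreal_def order_le_less_trans)
  moreover have "enn2real I \<le> e"
    using assms(1,3) unfolding I_def[symmetric] by (simp add: enn2real_leI)
  ultimately show ?thesis
    unfolding Lq_norm_def I_def[symmetric] Let_def using assms(2)
    by (auto intro!: ennreal_leI powr_mono2)
qed

lemma Lq_norm_finite_if_bounded:
  assumes "prob_space P" "q > 0" "\<And>x. \<bar>f x\<bar> \<le> B"
  shows "Lq_norm P q f < \<infinity>"
proof -
  interpret prob_space P by fact
  have "(\<integral>\<^sup>+x. ennreal (\<bar>f x\<bar> powr q) \<partial>P) \<le> (\<integral>\<^sup>+x. ennreal (B powr q) \<partial>P)"
    using assms by (intro nn_integral_mono ennreal_leI powr_mono2) auto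
  also have "\<dots> = ennreal (B powr q)" by (simp add: emeasure_space_1)
  finally have "Lq_norm P q f \<le> ennreal ((B powr q) powr (1 / q))"
    using assms(2) by (intro Lq_norm_le) auto
  then show ?thesis
    by (metis ennreal_less_top infinity_ennreal_def order_le_less_trans)
qed

text \<open>Bounded ends have finite norm, and the size of a bracket is at most the
  \<open>q\<close>-th root of \<open>e\<close>. The inequality with \<epsilon> is strict because
  \<open>bracketing_number\<close> asks for sizes strictly below \<epsilon>.\<close>

lemma bracketing_number_le_if_bracketed:
  assumes "bracketed P q (space P) N e \<F>" "prob_space P" "q > 0" "e \<ge> 0" "e powr (1 / q) < \<epsilon>"
  shows "bracketing_number P q \<epsilon> \<F> \<le> enat N"
proof -
  obtain A where A: "finite A" "card A \<le> N"
    "\<forall>(l, u)\<in>A. l \<in> borel_measurable P \<and> u \<in> borel_measurable P \<and>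
        (\<exists>B. \<forall>x. \<bar>l x\<bar> \<le> B \<and> \<bar>u x\<bar> \<le> B) \<and>
        (\<integral>\<^sup>+x\<in>space P. ennreal (\<bar>u x - l x\<bar> powr q) \<partial>P) \<le> ennreal e"
     "\<F> \<subseteq> (\<Union>(l, u)\<in>A. bracket (space P) l u)"
    using assms(1) unfolding bracketed_def small_bracket_def by blast
  have "Lq_norm P q l < \<infinity> \<and> Lq_norm P q u < \<infinity> \<and> Lq_norm P q (\<lambda>x. u x - l x) < ennreal \<epsilon>"
    if lu: "(l, u) \<in> A" for l u
  proof (intro conjI)
    obtain B where "\<And>x. \<bar>l x\<bar> \<le> B \<and> \<bar>u x\<bar> \<le> B" using A(3) lu by blast
    then show "Lq_norm P q l < \<infinity>" "Lq_norm P q u < \<infinity>"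
      using assms(2,3) Lq_norm_finite_if_bounded by metis+
    have "(\<integral>\<^sup>+x. ennreal (\<bar>u x - l x\<bar> powr q) \<partial>P) = (\<integral>\<^sup>+x\<in>space P. ennreal (\<bar>u x - l x\<bar> powr q) \<partial>P)"
      by (intro nn_integral_cong) auto
    also have "\<dots> \<le> ennreal e" using A(3) lu by blast
    finally have "Lq_norm P q (\<lambda>x. u x - l x) \<le> ennreal (e powr (1 / q))"
      using assms by (intro Lq_norm_le)
    also have "\<dots> < ennreal \<epsilon>"
      using assms(5) by (intro ennreal_lessI) (auto intro: order_le_less_trans[OF powr_ge_zero])
    finally show "Lq_norm P q (\<lambda>x. u x - l x) < ennreal \<epsilon>" .
  qed
  with A have "bracketing_number P q \<epsilon> \<F> \<le> enat (card A)"
    unfolding bracketing_number_def by (intro Inf_lower CollectI exI[of _ A]) auto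
  also have "\<dots> \<le> enat N" using A(2) by simp
  finally show ?thesis .
qed

section \<open>Monotone counts\<close>

text \<open>Points on the same level of \<open>F\<close> may carry different counts: a monotone
  function of a variable need not be a function of its cdf, since the cdf can be flat.\<close>

definition monotone_counts :: "('a \<Rightarrow> real) \<Rightarrow> 'a set \<Rightarrow> nat \<Rightarrow> ('a \<Rightarrow> real) set" where
  "monotone_counts F D k = {f. \<exists>g :: 'a \<Rightarrow> nat. (\<forall>x\<in>D. f x = real (g x) \<and> g x \<le> k) \<and>
     (\<forall>x\<in>D. \<forall>y\<in>D. F x < F y \<longrightarrow> g x \<le> g y)}"

text \<open>Half-open, so that adjacent cells are disjoint and every level in one cell lies strictly
  below every level in the next.\<close>

definition level_cell :: "'a measure \<Rightarrow> ('a \<Rightarrow> real) \<Rightarrow> real \<Rightarrow> real \<Rightarrow> 'a set" where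
  "level_cell P F s w = {x \<in> space P. s \<le> F x \<and> F x < s + w}"

lemma level_cell_sets [measurable]:
  assumes [measurable]: "F \<in> borel_measurable P"
  shows "level_cell P F s w \<in> sets P"
  unfolding level_cell_def by measurable

text \<open>The bracket with constant ends \<open>a\<close> and \<open>b\<close> costs the mass of
  \<open>D\<close> times a \<open>q\<close>-th power of the height; the recursion on cells starts
  from it.\<close>

lemma bracketed_trivial:
  assumes "emeasure P D \<le> ennreal w" "D \<in> sets P" "w \<ge> 0" "a \<le> b"
  shows "bracketed P q D 1 (w * (b - a) powr q) {f. \<forall>x\<in>D. a \<le> f x \<and> f x \<le> b}"
proof (rule bracketedI[of "{(\<lambda>_. a, \<lambda>_. b)}"])
  fix l u assume "(l, u) \<in> {(\<lambda>_::'a. a, \<lambda>_::'a. b)}"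
  then have lu: "l = (\<lambda>_. a)" "u = (\<lambda>_. b)" by auto
  show "l \<in> borel_measurable P" "u \<in> borel_measurable P" by (auto simp: lu)
  show "\<exists>B. \<forall>x. \<bar>l x\<bar> \<le> B \<and> \<bar>u x\<bar> \<le> B"
    by (auto simp: lu intro: exI[of _ "max \<bar>a\<bar> \<bar>b\<bar>"])
  have "(\<integral>\<^sup>+x\<in>D. ennreal (\<bar>u x - l x\<bar> powr q) \<partial>P) = ennreal ((b - a) powr q) * emeasure P D"
    using assms(2,4) by (simp add: lu nn_integral_cmult_indicator)
  also have "\<dots> \<le> ennreal ((b - a) powr q) * ennreal w"
    using assms(1) by (rule mult_left_mono) simp
  finally show "(\<integral>\<^sup>+x\<in>D. ennreal (\<bar>u x - l x\<bar> powr q) \<partial>P) \<le> ennreal (w * (b - a) powr q)"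
    using assms(3) by (simp add: ennreal_mult mult.commute)
qed auto

text \<open>Write \<open>x powr p\<close> as \<open>x * x powr (p - 1)\<close> and enlarge the
  second factor to \<open>(a + b) powr (p - 1)\<close>. It lets the errors of several cells add up
  to the error of their total count.\<close>

lemma powr_superadditive:
  fixes a b p :: real
  assumes "a \<ge> 0" "b \<ge> 0" "p \<ge> 1"
  shows "a powr p + b powr p \<le> (a + b) powr p"
proof -
  have split: "x powr p = x * x powr (p - 1)" if "x \<ge> 0" for x :: real
    using that by (cases "x = 0") (auto simp: powr_diff)
  have "a powr p + b powr p \<le> a * (a + b) powr (p - 1) + b * (a + b) powr (p - 1)"
    unfolding split[OF assms(1)] split[OF assms(2)]
    using assms by (intro add_mono mult_left_mono powr_mono2) auto
  also have "\<dots> = (a + b) powr p"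
    using assms split[of "a + b"] by (simp add: algebra_simps)
  finally show ?thesis .
qed

lemma sum_power_diff_le: "(\<Sum>b\<le>k. 2 ^ (j + (k - b))) \<le> (2 ^ (Suc j + k) :: nat)"
proof -
  have "(\<Sum>b\<le>k. 2 ^ (k - b)) \<le> (2 ^ Suc k :: nat)"
    by (induction k) (simp_all add: sum.atMost_Suc_shift del: sum.atMost_Suc)
  then have "2 ^ j * (\<Sum>b\<le>k. 2 ^ (k - b)) \<le> 2 ^ j * (2 ^ Suc k :: nat)"
    by (rule mult_left_mono) simp
  moreover have "(\<Sum>b\<le>k. 2 ^ (j + (k - b))) = 2 ^ j * (\<Sum>b\<le>k. 2 ^ (k - b) :: nat)"
    by (simp only: power_add sum_distrib_left)
  ultimately show ?thesis by (simp add: power_add)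
qed

text \<open>Let \<open>b\<close> be the least upper bound of the counts on \<open>D1\<close>. Any
  count on \<open>D2\<close> also bounds those on \<open>D1\<close>, hence is at least
  \<open>b\<close>, and subtracting \<open>b\<close> leaves at most \<open>k - b\<close>.\<close>

lemma monotone_counts_split:
  assumes f: "f \<in> monotone_counts F D k" and D: "D = D1 \<union> D2"
    and less: "\<And>x y. x \<in> D1 \<Longrightarrow> y \<in> D2 \<Longrightarrow> F x < F y"
  obtains b f' where "b \<le> k" "f \<in> monotone_counts F D1 b"
    "f' \<in> monotone_counts F D2 (k - b)" "\<And>x. x \<in> D2 \<Longrightarrow> f x = real b + f' x"
proof -
  obtain g :: "'a \<Rightarrow> nat" where g: "\<forall>x\<in>D. f x = real (g x) \<and> g x \<le> k"
    "\<forall>x\<in>D. \<forall>y\<in>D. F x < F y \<longrightarrow> g x \<le> g y"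
    using f unfolding monotone_counts_def by blast
  \<comment> \<open>If \<open>D1\<close> is empty this is 0, so no separate case arises.\<close>
  define b where "b = (LEAST b. \<forall>x\<in>D1. g x \<le> b)"
  have k: "\<forall>x\<in>D1. g x \<le> k" using g D by blast
  have b1: "\<forall>x\<in>D1. g x \<le> b"
    unfolding b_def using k by (rule LeastI)
  have bk: "b \<le> k" unfolding b_def using k by (rule Least_le)
  have b2: "b \<le> g y" if "y \<in> D2" for y
    unfolding b_def using g(2) less[OF _ that] that D by (intro Least_le) auto
  show thesis
  proof (rule that[OF bk])
    show "f \<in> monotone_counts F D1 b"
      unfolding monotone_counts_def using g D b1 by auto
    show "(\<lambda>x. real (g x - b)) \<in> monotone_counts F D2 (k - b)"
      unfolding monotone_counts_def using g D by (auto intro!: exI[of _ "\<lambda>x. g x - b"] diff_le_mono)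
    show "f x = real b + real (g x - b)" if "x \<in> D2" for x
      using b2[OF that] g(1) D that by auto
  qed
qed

text \<open>Sum over the part \<open>b\<close> of \<open>k\<close> spent on the first cell. A
  bracket number of the form \<open>c ^ k\<close> is kept by every split, since
  \<open>c ^ b * c ^ (k - b) = c ^ k\<close>; the factor \<open>2 ^ (j + k)\<close> bounds the ways
  to distribute \<open>k\<close> over \<open>j\<close> cells. The errors are superadditive in the
  counts.\<close>

lemma bracketed_consecutive_cells:
  assumes [measurable]: "F \<in> borel_measurable P" and "v \<ge> 0" "p \<ge> 1"
    and cell: "\<And>s k. bracketed P q (level_cell P F s v) (c ^ k) (v * real k powr p)
       (monotone_counts F (level_cell P F s v) k)"
  shows "bracketed P q (level_cell P F s (real j * v)) (2 ^ (j + k) * c ^ k) (v * real k powr p)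
       (monotone_counts F (level_cell P F s (real j * v)) k)"
proof (induction j arbitrary: s k)
  case 0
  have D: "level_cell P F s (real 0 * v) = {}" by (auto simp: level_cell_def)
  \<comment> \<open>With \<open>j = 0\<close> the region is empty and one bracket suffices. The
    claimed number is at least one because the zero function must be covered in the assumption
    \<open>cell\<close>.\<close>
  have "1 \<le> c ^ k"
  proof (rule ccontr)
    assume "\<not> 1 \<le> c ^ k"
    then have "c ^ k = 0" by linarith
    with cell[of s k] have "monotone_counts F (level_cell P F s v) k = {}"
      unfolding bracketed_def by (metis card_0_eq le_zero_eq Union_empty image_empty subset_empty)
    moreover have "(\<lambda>_. 0) \<in> monotone_counts F (level_cell P F s v) k"
      unfolding monotone_counts_def by (auto intro!: exI[of _ "\<lambda>_. 0"])
    ultimately show False by simp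
  qed
  then show ?case
    unfolding D
    by (intro bracketed_mono[OF bracketed_trivial[of P "{}" 0 0 0 q]]) (use \<open>v \<ge> 0\<close> in auto)
next
  case (Suc j)
  let ?D = "level_cell P F s (real (Suc j) * v)"
  let ?D1 = "level_cell P F s v" and ?D2 = "level_cell P F (s + v) (real j * v)"
  have jv: "real (Suc j) * v = v + real j * v" "real j * v \<ge> 0"
    using \<open>v \<ge> 0\<close> by (auto simp: algebra_simps)
  have "level_cell P F s (v + a) = ?D1 \<union> level_cell P F (s + v) a"
    "?D1 \<inter> level_cell P F (s + v) a = {}" if "a \<ge> 0" for a
    using that \<open>v \<ge> 0\<close> unfolding level_cell_def by auto
  from this[OF jv(2)] have D: "?D = ?D1 \<union> ?D2" "?D1 \<inter> ?D2 = {}"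
    unfolding jv(1) .
  \<comment> \<open>The possible behaviour on the remaining cells once the first cell has used up
    \<open>b\<close>.\<close>
  define \<F>2 where "\<F>2 b = {f. \<exists>g\<in>monotone_counts F ?D2 (k - b). \<forall>x\<in>?D2. f x = real b + g x}" for b
  have "bracketed P q ?D (\<Sum>b\<le>k. c ^ b * (2 ^ (j + (k - b)) * c ^ (k - b))) (v * real k powr p)
     (\<Union>b\<le>k. monotone_counts F ?D1 b \<inter> \<F>2 b)"
  proof (rule bracketed_UN)
    fix b assume "b \<in> {..k}"
    have "bracketed P q ?D2 (2 ^ (j + (k - b)) * c ^ (k - b)) (v * real (k - b) powr p) (\<F>2 b)"
      by (rule bracketed_mono[OF bracketed_affine[OF Suc.IH[of "s + v" "k - b"], of 1 "real b"]])
        (use \<open>v \<ge> 0\<close> in \<open>auto simp: \<F>2_def\<close>)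
    from bracketed_split[OF cell this]
    have B: "bracketed P q (?D1 \<union> ?D2) (c ^ b * (2 ^ (j + (k - b)) * c ^ (k - b)))
      (v * real b powr p + v * real (k - b) powr p) (monotone_counts F ?D1 b \<inter> \<F>2 b)"
      using D(2) \<open>v \<ge> 0\<close> by simp
    have err: "v * real b powr p + v * real (k - b) powr p \<le> v * real k powr p"
    proof -
      have "real b powr p + real (k - b) powr p \<le> (real b + real (k - b)) powr p"
        using \<open>p \<ge> 1\<close> by (intro powr_superadditive) auto
      also have "real b + real (k - b) = real k" using \<open>b \<in> {..k}\<close> by simp
      finally show ?thesis using mult_left_mono[OF _ \<open>v \<ge> 0\<close>] by (simp add: distrib_left[symmetric])
    qed
    show "bracketed P q ?D (c ^ b * (2 ^ (j + (k - b)) * c ^ (k - b))) (v * real k powr p)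
       (monotone_counts F ?D1 b \<inter> \<F>2 b)"
      unfolding D(1) by (rule bracketed_mono[OF B order.refl err]) blast
  qed simp
  then show ?case
  proof (rule bracketed_mono)
    have "(\<Sum>b\<le>k. c ^ b * (2 ^ (j + (k - b)) * c ^ (k - b))) = (\<Sum>b\<le>k. 2 ^ (j + (k - b))) * c ^ k"
      unfolding sum_distrib_right
      by (intro sum.cong refl) (simp add: mult.left_commute flip: power_add)
    also have "\<dots> \<le> 2 ^ (Suc j + k) * c ^ k"
      using sum_power_diff_le by (intro mult_right_mono) auto
    finally show "(\<Sum>b\<le>k. c ^ b * (2 ^ (j + (k - b)) * c ^ (k - b))) \<le> 2 ^ (Suc j + k) * c ^ k" .
  next
    fix f assume "f \<in> monotone_counts F ?D k"
    then obtain b f' where "b \<le> k" "f \<in> monotone_counts F ?D1 b"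
      "f' \<in> monotone_counts F ?D2 (k - b)" "\<And>x. x \<in> ?D2 \<Longrightarrow> f x = real b + f' x"
      using D(1) by (rule monotone_counts_split) (auto simp: level_cell_def)
    then show "\<exists>g\<in>\<Union>b\<le>k. monotone_counts F ?D1 b \<inter> \<F>2 b. \<forall>x\<in>?D. f x = g x"
      unfolding \<F>2_def by auto
  qed simp
qed

text \<open>
  Each round splits a cell carrying total increment \<open>k\<close> into \<open>k\<close> cells of equal mass at the price
  of \<open>4^k\<close> brackets, and lowers by one the power of \<open>k\<close> in the error; \<open>r \<ge> q\<close> rounds
  make the error independent of \<open>k\<close> while the number of brackets stays exponential in \<open>k\<close>.
\<close>

lemma bracketed_monotone_counts:
  assumes [measurable]: "F \<in> borel_measurable P" and "q \<ge> 1"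
    and mass: "\<And>s w. w \<ge> 0 \<Longrightarrow> emeasure P (level_cell P F s w) \<le> ennreal w" and "w \<ge> 0"
  shows "bracketed P q (level_cell P F s w) (4 ^ (r * k)) (w * real k powr max (q - real r) 0)
       (monotone_counts F (level_cell P F s w) k)"
  using \<open>w \<ge> 0\<close>
proof (induction r arbitrary: s w k)
  case 0
  show ?case
  proof (rule bracketed_mono[OF bracketed_trivial[OF mass[OF 0, of s] _ 0, of 0 "real k"]])
    fix f assume f: "f \<in> monotone_counts F (level_cell P F s w) k"
    show "\<exists>g\<in>{f. \<forall>x\<in>level_cell P F s w. 0 \<le> f x \<and> f x \<le> real k}. \<forall>x\<in>level_cell P F s w. f x = g x"
      by (rule bexI[of _ f]) (use f in \<open>auto simp: monotone_counts_def\<close>)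
  qed (use \<open>q \<ge> 1\<close> in auto)
next
  case (Suc r)
  show ?case
  proof (cases "k = 0")
    \<comment> \<open>There are no parts to split into; the only count is zero, which a bracket of
      height 0 covers.\<close>
    case True
    show ?thesis
    proof (rule bracketed_mono[OF bracketed_trivial[OF mass[OF Suc.prems, of s] _ Suc.prems, of 0 0]])
      fix f assume f: "f \<in> monotone_counts F (level_cell P F s w) k"
      show "\<exists>g\<in>{f. \<forall>x\<in>level_cell P F s w. 0 \<le> f x \<and> f x \<le> 0}. \<forall>x\<in>level_cell P F s w. f x = g x"
        by (rule bexI[of _ f]) (use f True in \<open>auto simp: monotone_counts_def\<close>)
    qed (auto simp: True)
  next
    case False
    define v where "v = w / real k"
    \<comment> \<open>Superadditivity needs an exponent of at least 1. Division of the width by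
      \<open>k\<close> then lowers \<open>p\<close> to \<open>p - 1\<close>, which is exactly
      \<open>max (q - real (Suc r)) 0\<close>.\<close>
    define p where "p = max (q - real r) 1"
    have v: "v \<ge> 0" "real k * v = w" using Suc.prems False by (auto simp: v_def)
    have "bracketed P q (level_cell P F s v) ((4 ^ r) ^ k') (v * real k' powr p)
       (monotone_counts F (level_cell P F s v) k')" for s k'
    proof (rule bracketed_mono[OF Suc.IH[OF v(1)]])
      show "v * real k' powr max (q - real r) 0 \<le> v * real k' powr p"
        using v(1) by (cases "k' = 0") (auto simp: p_def intro!: mult_left_mono powr_mono)
    qed (auto simp: power_mult)
    then have "bracketed P q (level_cell P F s (real k * v)) (2 ^ (k + k) * (4 ^ r) ^ k) (v * real k powr p)
       (monotone_counts F (level_cell P F s (real k * v)) k)"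
      using v(1) by (intro bracketed_consecutive_cells) (auto simp: p_def)
    moreover have "2 ^ (k + k) * (4 ^ r) ^ k = (4 ^ (Suc r * k) :: nat)"
    proof -
      have "2 ^ (k + k) = (4 ^ k :: nat)"
        unfolding power_add power_mult_distrib[symmetric] by simp
      then show ?thesis by (simp add: power_add flip: power_mult)
    qed
    moreover have "v * real k powr p = w * real k powr max (q - real (Suc r)) 0"
    proof -
      have "max (q - real (Suc r)) 0 = p - 1" by (auto simp: p_def)
      then show ?thesis using False by (simp add: v_def powr_diff)
    qed
    ultimately show ?thesis by (simp add: v(2))
  qed
qed

section \<open>Perturbing a variable with bounded density\<close>

text \<open>Probability integral transform: \<open>M\<close> is the image of the uniform
  distribution on (0,1) under the quantile function \<open>I\<close>. Continuity makes
  \<open>C (I \<omega>) = \<omega>\<close>, so the set in question pulls back into an interval of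
  length \<open>w\<close>.\<close>

lemma (in real_distribution) emeasure_cdf_between:
  assumes cont: "\<And>x. isCont (cdf M) x" and "w \<ge> 0"
  shows "emeasure M {t. s \<le> cdf M t \<and> cdf M t < s + w} \<le> ennreal w"
proof -
  interpret cdf_distribution M by unfold_locales
  define A where "A = {t. s \<le> cdf M t \<and> cdf M t < s + w}"
  have A: "A \<in> sets borel"
    unfolding A_def by measurable
  have CI: "C (I \<omega>) = \<omega>" if \<omega>: "0 < \<omega>" "\<omega> < 1" for \<omega>
  proof (rule antisym)
    \<comment> \<open>Strictly to the left of the quantile the cdf stays below \<omega>; continuity
      carries the bound to the quantile itself.\<close>
    have "C x \<le> \<omega>" if "x < I \<omega>" for x
      using pseudoinverse[OF \<omega>, of x] that by linarith
    then have "eventually (\<lambda>x. C x \<le> \<omega>) (at_left (I \<omega>))"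
      by (auto simp: eventually_at_filter)
    moreover have "(C \<longlongrightarrow> C (I \<omega>)) (at_left (I \<omega>))"
      using assms(1)[of "I \<omega>"] by (auto simp: isCont_def intro: tendsto_mono[OF at_le])
    ultimately show "C (I \<omega>) \<le> \<omega>"
      by (intro tendsto_upperbound[of C "C (I \<omega>)" "at_left (I \<omega>)"]) auto
    show "\<omega> \<le> C (I \<omega>)" using pseudoinverse[OF \<omega>, of "I \<omega>"] by simp
  qed
  let ?\<Omega> = "restrict_space lborel {0<..<1::real}"
  have "emeasure M A = emeasure (distr ?\<Omega> borel I) A" by (simp add: distr_I_eq_M)
  also have "\<dots> = emeasure ?\<Omega> (I -` A \<inter> space ?\<Omega>)"
    using A by (intro emeasure_distr) auto
  also have "\<dots> \<le> emeasure ?\<Omega> ({s..s + w} \<inter> {0<..<1})"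
    using CI by (intro emeasure_mono) (auto simp: A_def space_restrict_space sets_restrict_space)
  also have "\<dots> = emeasure lborel ({s..s + w} \<inter> {0<..<1})"
    by (subst emeasure_restrict_space) auto
  also have "\<dots> \<le> emeasure lborel {s..s + w}"
    by (intro emeasure_mono) auto
  also have "\<dots> = ennreal w" using \<open>w \<ge> 0\<close> by simp
  finally show ?thesis unfolding A_def .
qed

section \<open>Bounded densities and shifted monotone functions\<close>

lemma emeasure_le_of_density_bounded:
  assumes "distributed P lborel lam p" "\<And>t. p t \<le> ennreal M" "A \<in> sets borel"
  shows "emeasure P (lam -` A \<inter> space P) \<le> ennreal M * emeasure lborel A"
proof -
  have "emeasure P (lam -` A \<inter> space P) = (\<integral>\<^sup>+x. p x * indicator A x \<partial>lborel)"
    using assms by (intro distributed_emeasure) auto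
  also have "\<dots> \<le> (\<integral>\<^sup>+x. ennreal M * indicator A x \<partial>lborel)"
    using assms(2) by (intro nn_integral_mono mult_right_mono) auto
  also have "\<dots> = ennreal M * emeasure lborel A"
    using assms(3) by (intro nn_integral_cmult_indicator) auto
  finally show ?thesis .
qed

text \<open>Layer by layer: the integrand counts the levels \<open>i < m\<close> that
  \<open>H\<close> passes between \<open>lam x - \<delta>\<close> and
  \<open>lam x + \<delta>\<close>. For each level the points with this property fill at most an
  interval of length \<open>4 * \<delta>\<close>, whose probability the density bounds.\<close>

lemma nn_integral_monotone_shift_le:
  fixes H :: "real \<Rightarrow> nat"
  assumes X: "distributed P lborel lam p" "\<And>t. p t \<le> ennreal M" and "M \<ge> 0" "\<delta> \<ge> 0"
    and H: "mono H" "\<And>t. H t \<le> m"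
  shows "(\<integral>\<^sup>+x. ennreal (real (H (lam x + \<delta>)) - real (H (lam x - \<delta>))) \<partial>P) \<le> ennreal (real m * (M * (4 * \<delta>)))"
proof -
  have [measurable]: "lam \<in> borel_measurable P"
    using distributed_measurable[OF X(1)] by simp
  have [measurable]: "(\<lambda>t. real (H t)) \<in> borel_measurable borel"
    using H(1) by (intro borel_measurable_mono) (auto simp: mono_def)
  define T where "T i = {t. H (t - \<delta>) \<le> i \<and> i < H (t + \<delta>)}" for i
  have [measurable]: "T i \<in> sets borel" for i
  proof -
    have "{t \<in> space borel. real (H (t - \<delta>)) \<le> real i \<and> real i < real (H (t + \<delta>))} \<in> sets borel"
      by measurable
    then show ?thesis by (simp add: T_def)
  qed
  have "ennreal (real (H (lam x + \<delta>)) - real (H (lam x - \<delta>))) = (\<Sum>i<m. indicator (T i) (lam x))" for x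
  proof -
    have "H (lam x - \<delta>) \<le> H (lam x + \<delta>)" using \<open>\<delta> \<ge> 0\<close> by (intro monoD[OF H(1)]) auto
    moreover have "(\<Sum>i<m. indicator (T i) (lam x) :: ennreal) = of_nat (card {H (lam x - \<delta>)..<H (lam x + \<delta>)})"
    proof -
      have "(\<Sum>i<m. indicator (T i) (lam x) :: ennreal) = (\<Sum>i<m. if i \<in> {H (lam x - \<delta>)..<H (lam x + \<delta>)} then 1 else 0)"
        by (intro sum.cong) (auto simp: T_def indicator_def)
      also have "\<dots> = of_nat (card ({..<m} \<inter> {H (lam x - \<delta>)..<H (lam x + \<delta>)}))"
        by (subst sum.If_cases) (auto intro!: arg_cong[where f = card])
      also have "{..<m} \<inter> {H (lam x - \<delta>)..<H (lam x + \<delta>)} = {H (lam x - \<delta>)..<H (lam x + \<delta>)}"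
        using H(2)[of "lam x + \<delta>"] by auto
      finally show ?thesis .
    qed
    ultimately show ?thesis by (simp add: ennreal_of_nat_eq_real_of_nat of_nat_diff)
  qed
  then have "(\<integral>\<^sup>+x. ennreal (real (H (lam x + \<delta>)) - real (H (lam x - \<delta>))) \<partial>P) =
     (\<Sum>i<m. \<integral>\<^sup>+x. indicator (T i) (lam x) \<partial>P)"
    by (simp add: nn_integral_sum)
  also have "\<dots> \<le> (\<Sum>i<m. ennreal (M * (4 * \<delta>)))"
  proof (rule sum_mono)
    fix i assume "i \<in> {..<m}"
    have "(\<integral>\<^sup>+x. indicator (T i) (lam x) \<partial>P) = (\<integral>\<^sup>+x. indicator (lam -` T i \<inter> space P) x \<partial>P)"
      by (intro nn_integral_cong) (auto simp: indicator_def)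
    also have "\<dots> = emeasure P (lam -` T i \<inter> space P)"
      by (intro nn_integral_indicator) measurable
    also have "\<dots> \<le> ennreal M * emeasure lborel (T i)"
      by (intro emeasure_le_of_density_bounded[OF X]) auto
    also have "emeasure lborel (T i) \<le> ennreal (4 * \<delta>)"
    proof (cases "T i = {}")
      case False
      then obtain t where t: "t \<in> T i" by blast
      \<comment> \<open>If \<open>t' + \<delta> \<le> t - \<delta>\<close>, then
        \<open>i < H (t' + \<delta>) \<le> H (t - \<delta>) \<le> i\<close>, a contradiction; the
        other order is symmetric.\<close>
      have "\<bar>t' - t\<bar> \<le> 2 * \<delta>" if "t' \<in> T i" for t'
      proof (rule ccontr)
        assume "\<not> \<bar>t' - t\<bar> \<le> 2 * \<delta>"
        then consider "t' + \<delta> \<le> t - \<delta>" | "t + \<delta> \<le> t' - \<delta>" by linarith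
        then show False
          using that t monoD[OF H(1), of "t' + \<delta>" "t - \<delta>"] monoD[OF H(1), of "t + \<delta>" "t' - \<delta>"]
          unfolding T_def by cases auto
      qed
      then have "T i \<subseteq> {t - 2 * \<delta>..t + 2 * \<delta>}" by (fastforce simp: abs_le_iff)
      then have "emeasure lborel (T i) \<le> emeasure lborel {t - 2 * \<delta>..t + 2 * \<delta>}"
        by (intro emeasure_mono) auto
      then show ?thesis using \<open>\<delta> \<ge> 0\<close> by simp
    qed simp
    finally show "(\<integral>\<^sup>+x. indicator (T i) (lam x) \<partial>P) \<le> ennreal (M * (4 * \<delta>))"
      using assms(3,4) by (simp add: ennreal_mult mult_left_mono)
  qed
  also have "\<dots> = ennreal (real m * (M * (4 * \<delta>)))"
    using assms(3,4) by (simp add: ennreal_mult ennreal_of_nat_eq_real_of_nat)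
  finally show ?thesis .
qed

text \<open>After scaling by \<open>m\<close> and rounding down, \<open>h\<close> becomes a count
  \<open>H\<close>. The composition lies between \<open>H (lam x - \<delta>)\<close> and
  \<open>1 + H (lam x + \<delta>)\<close>, both monotone in the single variable \<open>lam\<close>,
  whatever \<open>Y\<close> is. Counts are bracketed on the cdf levels of \<open>lam\<close>, and
  the gap is a shift error plus the rounding unit.\<close>

lemma bracketed_monotone_compositions:
  assumes "prob_space P" and X: "distributed P lborel lam p" "\<And>t. p t \<le> ennreal M"
    and "M \<ge> 0" "\<delta> \<ge> 0" "q \<ge> 1" "m \<ge> 1" "real r \<ge> q"
  shows "bracketed P q (space P) (4 ^ (2 * r * m))
    ((1 / real m) powr q * (3 powr q * (4 + 3 powr q * (real m powr q * (M * (4 * \<delta>)) + 1))))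
    {\<lambda>x. h (Y x) | h Y. mono h \<and> (\<forall>t. 0 \<le> h t \<and> h t \<le> 1) \<and> (\<forall>x\<in>space P. \<bar>Y x - lam x\<bar> \<le> \<delta>)}"
proof -
  interpret P: prob_space P by fact
  have lam [measurable]: "lam \<in> borel_measurable P"
    using distributed_measurable[OF X(1)] by simp
  define D where "D = distr P borel lam"
  interpret D: real_distribution D unfolding D_def by (rule P.real_distribution_distr) simp
  define F where "F x = cdf D (lam x)" for x
  have cdf_meas [measurable]: "cdf D \<in> borel_measurable borel"
    by (intro borel_measurable_mono monoI D.cdf_nondecreasing)
  have F [measurable]: "F \<in> borel_measurable P" unfolding F_def by measurable
  have F01: "0 \<le> F x" "F x \<le> 1" for x
    unfolding F_def by (auto intro: D.cdf_nonneg D.cdf_bounded_prob)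
  \<comment> \<open>A bounded density leaves no atoms.\<close>
  have "isCont (cdf D) t" for t
  proof -
    have "emeasure D {t} \<le> ennreal M * emeasure lborel {t}"
      using emeasure_le_of_density_bounded[OF X, of "{t}"] unfolding D_def by (simp add: emeasure_distr)
    then show ?thesis by (simp add: D.isCont_cdf measure_def)
  qed
  note between = D.emeasure_cdf_between[OF this]
  have mass: "emeasure P (level_cell P F s w) \<le> ennreal w" if "w \<ge> 0" for s w
  proof -
    have meas: "{t \<in> space borel. s \<le> cdf D t \<and> cdf D t < s + w} \<in> sets borel" by measurable
    have "emeasure P (level_cell P F s w) = emeasure D {t. s \<le> cdf D t \<and> cdf D t < s + w}"
      unfolding D_def using meas
      by (subst emeasure_distr)
        (auto simp: level_cell_def F_def D_def intro!: arg_cong[where f = "emeasure P"])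
    with between[OF that] show ?thesis by simp
  qed
  \<comment> \<open>Cells are open on the right and \<open>F\<close> may equal 1, so width 1 could
    miss points; width 2 is the origin of the error 2 below.\<close>
  have cell: "level_cell P F 0 2 = space P"
    using F01 order_le_less_trans[OF F01(2), of 2] by (auto simp: level_cell_def)
  have "max (q - real r) 0 = 0" using \<open>real r \<ge> q\<close> by simp
  then have B: "bracketed P q (space P) (4 ^ (r * m)) 2 (monotone_counts F (space P) m)"
    using bracketed_monotone_counts[OF F \<open>q \<ge> 1\<close> mass, of 2 0 r m] \<open>m \<ge> 1\<close> by (simp add: cell)
  have B': "bracketed P q (space P) (4 ^ (r * m)) 2 ((\<lambda>f x. 1 + 1 * f x) ` monotone_counts F (space P) m)"
    using bracketed_affine[OF B, of 1 1] by simp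
  define e where "e = 3 powr q * (real m powr q * (M * (4 * \<delta>)) + 1)"
  have "e \<ge> 0" using assms by (auto simp: e_def)
  let ?\<F> = "{\<lambda>x. h (Y x) | h Y. mono h \<and> (\<forall>t. 0 \<le> h t \<and> h t \<le> 1) \<and> (\<forall>x\<in>space P. \<bar>Y x - lam x\<bar> \<le> \<delta>)}"
  have "bracketed P q (space P) (4 ^ (r * m) * 4 ^ (r * m)) (3 powr q * (2 + 2 + e))
     ((\<lambda>f x. real m * f x) ` ?\<F>)"
  proof (rule bracketed_sandwich[OF B B'])
    fix f assume "f \<in> (\<lambda>f x. real m * f x) ` ?\<F>"
    then obtain h Y where f: "f = (\<lambda>x. real m * h (Y x))" and h: "mono h" "\<And>t. 0 \<le> h t \<and> h t \<le> 1"
      and Y: "\<And>x. x \<in> space P \<Longrightarrow> \<bar>Y x - lam x\<bar> \<le> \<delta>" by auto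
    define H where "H t = nat \<lfloor>real m * h t\<rfloor>" for t
    have H: "mono H"
      unfolding H_def using h(1) by (auto simp: mono_def intro!: nat_mono floor_mono mult_left_mono)
    have Hm: "H t \<le> m" for t
    proof -
      have "real m * h t \<le> real m * 1" using h(2) by (intro mult_left_mono) auto
      then show ?thesis unfolding H_def by (simp add: nat_le_iff floor_le_iff)
    qed
    have Hb: "real (H t) \<le> real m * h t" "real m * h t \<le> 1 + real (H t)" for t
    proof -
      have "0 \<le> real m * h t" using h(2)[of t] by auto
      then show "real (H t) \<le> real m * h t" "real m * h t \<le> 1 + real (H t)"
        unfolding H_def by linarith+
    qed
    have [measurable]: "(\<lambda>t. real (H t)) \<in> borel_measurable borel"
      using H by (intro borel_measurable_mono) (auto simp: mono_def)
    have mc: "(\<lambda>x. real (H (lam x + a))) \<in> monotone_counts F (space P) m" for a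
    proof -
      \<comment> \<open>A strict inequality of cdf values forces one of arguments, so a count
        monotone in \<open>lam\<close> is monotone across the levels of \<open>F\<close>.\<close>
      have "lam x < lam y" if "F x < F y" for x y
        using that D.cdf_nondecreasing[of "lam y" "lam x"] unfolding F_def by force
      then show ?thesis
        unfolding monotone_counts_def using Hm
        by (auto intro!: exI[of _ "\<lambda>x. H (lam x + a)"] monoD[OF H] simp: less_imp_le)
    qed
    define f1 where "f1 x = real (H (lam x - \<delta>))" for x
    define f2 where "f2 x = 1 + real (H (lam x + \<delta>))" for x
    have 1: "f1 \<in> monotone_counts F (space P) m"
      using mc[of "-\<delta>"] by (simp add: f1_def[abs_def])
    have 2: "f2 \<in> (\<lambda>f x. 1 + 1 * f x) ` monotone_counts F (space P) m"
      using imageI[OF mc[of \<delta>], of "\<lambda>f x. 1 + 1 * f x"] by (simp add: f2_def[abs_def])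
    have 3: "\<forall>x\<in>space P. f1 x \<le> f x \<and> f x \<le> f2 x"
    proof
      fix x assume "x \<in> space P"
      with Y[of x] have Yx: "lam x - \<delta> \<le> Y x" "Y x \<le> lam x + \<delta>" by auto
      have "f1 x \<le> real m * h (lam x - \<delta>)" unfolding f1_def by (rule Hb)
      also have "\<dots> \<le> real m * h (Y x)" by (intro mult_left_mono monoD[OF h(1)] Yx) auto
      finally have "f1 x \<le> f x" by (simp add: f)
      have "real m * h (Y x) \<le> real m * h (lam x + \<delta>)" by (intro mult_left_mono monoD[OF h(1)] Yx) auto
      also have "\<dots> \<le> f2 x" unfolding f2_def by (rule Hb)
      finally show "f1 x \<le> f x \<and> f x \<le> f2 x" using \<open>f1 x \<le> f x\<close> by (simp add: f)
    qed
    have meas: "f1 \<in> borel_measurable P" "f2 \<in> borel_measurable P"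
      unfolding f1_def[abs_def] f2_def[abs_def] by measurable
    have pw: "\<bar>f2 x - f1 x\<bar> powr q \<le>
      3 powr q * (real m powr (q - 1) * (real (H (lam x + \<delta>)) - real (H (lam x - \<delta>))) + 1)" for x
    proof -
      define d where "d = real (H (lam x + \<delta>)) - real (H (lam x - \<delta>))"
      have "H (lam x - \<delta>) \<le> H (lam x + \<delta>)" using \<open>\<delta> \<ge> 0\<close> by (intro monoD[OF H]) auto
      then have d: "0 \<le> d" "d \<le> real m" using Hm[of "lam x + \<delta>"] by (auto simp: d_def)
      have "\<bar>f2 x - f1 x\<bar> powr q = (d + 1 + 0) powr q"
        using d(1) by (simp add: f1_def f2_def d_def algebra_simps)
      also have "\<dots> \<le> 3 powr q * (d powr q + 1 powr q + 0 powr q)"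
        using d \<open>q \<ge> 1\<close> by (intro powr_sum3_le) auto
      \<comment> \<open>Since \<open>d \<le> m\<close>, the \<open>q\<close>-th power reduces to the
        first power, whose integral the shift bound controls.\<close>
      also have "d powr q \<le> real m powr (q - 1) * d"
      proof (cases "d = 0")
        case False
        then have "d powr q = d powr (q - 1) * d" using d(1) by (simp add: powr_diff)
        also have "\<dots> \<le> real m powr (q - 1) * d"
          using d \<open>q \<ge> 1\<close> by (intro mult_right_mono powr_mono2) auto
        finally show ?thesis .
      qed simp
      finally show ?thesis by (simp add: d_def)
    qed
    have "(\<integral>\<^sup>+x\<in>space P. ennreal (\<bar>f2 x - f1 x\<bar> powr q) \<partial>P) \<le>
       (\<integral>\<^sup>+x. ennreal (3 powr q) * (ennreal (real m powr (q - 1)) *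
          ennreal (real (H (lam x + \<delta>)) - real (H (lam x - \<delta>))) + 1) \<partial>P)"
    proof (intro nn_integral_mono)
      fix x assume "x \<in> space P"
      have "H (lam x - \<delta>) \<le> H (lam x + \<delta>)" using \<open>\<delta> \<ge> 0\<close> by (intro monoD[OF H]) auto
      then have "ennreal (3 powr q) * (ennreal (real m powr (q - 1)) *
          ennreal (real (H (lam x + \<delta>)) - real (H (lam x - \<delta>))) + 1) =
        ennreal (3 powr q * (real m powr (q - 1) * (real (H (lam x + \<delta>)) - real (H (lam x - \<delta>))) + 1))"
        by (simp add: ennreal_mult ennreal_plus)
      then show "ennreal (\<bar>f2 x - f1 x\<bar> powr q) * indicator (space P) x \<le> ennreal (3 powr q) *
         (ennreal (real m powr (q - 1)) * ennreal (real (H (lam x + \<delta>)) - real (H (lam x - \<delta>))) + 1)"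
        using pw[of x] \<open>x \<in> space P\<close> by (simp add: ennreal_leI)
    qed
    also have "\<dots> = ennreal (3 powr q) * (ennreal (real m powr (q - 1)) *
       (\<integral>\<^sup>+x. ennreal (real (H (lam x + \<delta>)) - real (H (lam x - \<delta>))) \<partial>P) + 1)"
      by (simp add: nn_integral_cmult nn_integral_add P.emeasure_space_1)
    also have "\<dots> \<le> ennreal (3 powr q) * (ennreal (real m powr (q - 1)) * ennreal (real m * (M * (4 * \<delta>))) + 1)"
      using nn_integral_monotone_shift_le[OF X \<open>M \<ge> 0\<close> \<open>\<delta> \<ge> 0\<close> H Hm]
      by (intro mult_left_mono add_right_mono) auto
    also have "\<dots> = ennreal (3 powr q * (real m powr (q - 1) * (real m * (M * (4 * \<delta>))) + 1))"
      using assms by (simp add: ennreal_mult ennreal_plus)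
    also have "real m powr (q - 1) * (real m * (M * (4 * \<delta>))) = real m powr q * (M * (4 * \<delta>))"
      using \<open>m \<ge> 1\<close> by (simp add: powr_diff)
    finally have 4: "(\<integral>\<^sup>+x\<in>space P. ennreal (\<bar>f2 x - f1 x\<bar> powr q) \<partial>P) \<le> ennreal e"
      unfolding e_def .
    show "\<exists>f1\<in>monotone_counts F (space P) m.
      \<exists>f2\<in>(\<lambda>f x. 1 + 1 * f x) ` monotone_counts F (space P) m.
      (\<forall>x\<in>space P. f1 x \<le> f x \<and> f x \<le> f2 x) \<and> f1 \<in> borel_measurable P \<and> f2 \<in> borel_measurable P \<and>
      (\<integral>\<^sup>+x\<in>space P. ennreal (\<bar>f2 x - f1 x\<bar> powr q) \<partial>P) \<le> ennreal e"
      by (intro bexI[OF _ 1] bexI[OF _ 2] conjI 3 meas 4)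
  qed (use \<open>e \<ge> 0\<close> \<open>q \<ge> 1\<close> in auto)
  \<comment> \<open>Undo the scaling by \<open>m\<close>.\<close>
  from bracketed_affine[OF this, of "1 / real m" 0]
  have S: "bracketed P q (space P) (4 ^ (r * m) * 4 ^ (r * m)) ((1 / real m) powr q * (3 powr q * (2 + 2 + e)))
    ((\<lambda>f x. 0 + 1 / real m * f x) ` (\<lambda>f x. real m * f x) ` ?\<F>)"
    using \<open>e \<ge> 0\<close> by simp
  have id: "(\<lambda>f x. 0 + 1 / real m * f x) ` (\<lambda>f x. real m * f x) ` \<F> = \<F>" for \<F> :: "('a \<Rightarrow> real) set"
    using \<open>m \<ge> 1\<close> by (simp add: image_image)
  have N: "4 ^ (r * m) * 4 ^ (r * m) = (4 ^ (2 * r * m) :: nat)"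
    by (simp flip: power_add)
  show ?thesis using S unfolding id N by (simp add: e_def)
qed

text \<open>With \<open>m\<close> the ceiling of \<open>1 / \<epsilon>\<close> and \<epsilon> at
  most 1, \<open>m\<close> lies between \<open>1 / \<epsilon>\<close> and
  \<open>2 / \<epsilon>\<close>. Then \<open>m powr q\<close> times the radius
  \<open>2 * \<epsilon> powr q\<close> stays bounded, so rounding and perturbation both contribute
  errors of order \<open>\<epsilon> powr q\<close>.\<close>

lemma bracketed_monotone_compositions_radius:
  assumes "prob_space P" and X: "distributed P lborel lam p" "\<And>t. p t \<le> ennreal M"
    and "M \<ge> 0" "q \<ge> 1" "real r \<ge> q" and \<epsilon>: "0 < \<epsilon>" "\<epsilon> \<le> 1"
  shows "bracketed P q (space P) (4 ^ (2 * r * nat \<lceil>1 / \<epsilon>\<rceil>))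
    (\<epsilon> powr q * (3 powr q * (4 + 3 powr q * (2 powr q * (8 * M) + 1))))
    {\<lambda>x. h (Y x) | h Y. mono h \<and> (\<forall>t. 0 \<le> h t \<and> h t \<le> 1) \<and>
       (\<forall>x\<in>space P. \<bar>Y x - lam x\<bar> \<le> 2 * \<epsilon> powr q)}"
proof -
  define m where "m = nat \<lceil>1 / \<epsilon>\<rceil>"
  have "1 / \<epsilon> \<ge> 1" using \<epsilon> by simp
  then have m: "m \<ge> 1" "real m \<ge> 1 / \<epsilon>" "real m \<le> 2 / \<epsilon>"
    unfolding m_def by linarith+
  have 1: "(1 / real m) powr q \<le> \<epsilon> powr q"
    using m \<epsilon> \<open>q \<ge> 1\<close> by (intro powr_mono2) (auto simp: field_simps)
  have 2: "real m powr q * (M * (4 * (2 * \<epsilon> powr q))) \<le> 2 powr q * (8 * M)"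
  proof -
    have "real m powr q * \<epsilon> powr q \<le> (2 / \<epsilon>) powr q * \<epsilon> powr q"
      using m \<open>q \<ge> 1\<close> by (intro mult_right_mono powr_mono2) auto
    also have "\<dots> = 2 powr q" using \<epsilon> by (simp flip: powr_mult)
    finally have "real m powr q * \<epsilon> powr q * (8 * M) \<le> 2 powr q * (8 * M)"
      using \<open>M \<ge> 0\<close> by (intro mult_right_mono) auto
    then show ?thesis by (simp add: mult_ac)
  qed
  have le: "(1 / real m) powr q * (3 powr q * (4 + 3 powr q * (real m powr q * (M * (4 * (2 * \<epsilon> powr q))) + 1)))
    \<le> \<epsilon> powr q * (3 powr q * (4 + 3 powr q * (2 powr q * (8 * M) + 1)))"
    using \<open>M \<ge> 0\<close>
    by (intro mult_mono[OF 1 mult_left_mono[OF add_left_mono[OF mult_left_mono[OF add_right_mono[OF 2]]]]]) auto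
  show ?thesis
    using bracketed_monotone_compositions[OF assms(1) X \<open>M \<ge> 0\<close> _ \<open>q \<ge> 1\<close> m(1) \<open>real r \<ge> q\<close>, of "2 * \<epsilon> powr q"]
    unfolding m_def[symmetric] by (rule bracketed_mono) (use le in auto)
qed

section \<open>Compositions with functions of bounded variation\<close>

text \<open>Jordan decomposition with the variation function \<open>T\<close>:
  \<open>f = (T + K) - (T - f + K)\<close>. The shift by \<open>K\<close> makes both parts
  nonnegative.\<close>

lemma total_variation_jordan:
  fixes f :: "real \<Rightarrow> real"
  assumes tv: "total_variation 0 1 f \<le> ennreal V" and "V \<ge> 0" and K: "\<And>v. v \<in> {0..1} \<Longrightarrow> \<bar>f v\<bar> \<le> K"
  obtains g h where "mono_on {0..1} g" "mono_on {0..1} h"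
    "\<And>v. v \<in> {0..1} \<Longrightarrow> 0 \<le> g v \<and> g v \<le> V + 2 * K" "\<And>v. v \<in> {0..1} \<Longrightarrow> 0 \<le> h v \<and> h v \<le> V + 2 * K"
    "\<And>v. v \<in> {0..1} \<Longrightarrow> f v = g v - h v"
proof -
  define A where "A v = {\<Sum>i<n. \<bar>f (t (Suc i)) - f (t i)\<bar> | (n::nat) (t :: nat \<Rightarrow> real).
     mono_on {..n} t \<and> t ` {..n} \<subseteq> {0..v}}" for v
  define T where "T v = Sup (A v)" for v
  have A_le: "a \<le> V" if a: "a \<in> A v" "v \<in> {0..1}" for a v
  proof -
    obtain n t where t: "a = (\<Sum>i<n. \<bar>f (t (Suc i)) - f (t i)\<bar>)" "mono_on {..n} t" "t ` {..n} \<subseteq> {0..v}"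
      using a(1) unfolding A_def by blast
    have "t ` {..n} \<subseteq> {0..1}" using t(3) a(2) by fastforce
    with t have "ennreal a \<le> total_variation 0 1 f"
      unfolding total_variation_def by (intro SUP_upper2[of "(n, t)"]) auto
    also note tv
    finally show ?thesis using \<open>V \<ge> 0\<close> by (simp add: ennreal_le_iff)
  qed
  have A0: "0 \<in> A v" if "v \<in> {0..1}" for v
    \<comment> \<open>The partition with \<open>n = 0\<close> has an empty sum; this keeps
      \<open>A v\<close> nonempty, as the suprema require.\<close>
    unfolding A_def using that by (auto intro!: exI[of _ 0] exI[of _ "\<lambda>_. 0"] simp: mono_on_def)
  have bdd: "bdd_above (A v)" if "v \<in> {0..1}" for v
    using A_le that by (auto intro!: bdd_aboveI[of _ V])
  have T01: "0 \<le> T v" "T v \<le> V" if "v \<in> {0..1}" for v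
    unfolding T_def using A0[OF that] A_le[OF _ that] bdd[OF that]
    by (auto intro!: cSup_upper cSup_least)
  have step: "T v + \<bar>f w - f v\<bar> \<le> T w" if "v \<in> {0..1}" "w \<in> {0..1}" "v \<le> w" for v w
  proof -
    have "a \<le> T w - \<bar>f w - f v\<bar>" if a: "a \<in> A v" for a
    proof -
      obtain n t where t: "a = (\<Sum>i<n. \<bar>f (t (Suc i)) - f (t i)\<bar>)" "mono_on {..n} t" "t ` {..n} \<subseteq> {0..v}"
        using a unfolding A_def by blast
      \<comment> \<open>Appending \<open>v\<close> and \<open>w\<close> to a partition inside [0,v]
        adds the increment from \<open>v\<close> to \<open>w\<close>, and the step up to
        \<open>v\<close> contributes a nonnegative term.\<close>
      define t' where "t' i = (if i \<le> n then t i else if i = Suc n then v else w)" for i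
      have tb: "0 \<le> t i" "t i \<le> v" if "i \<le> n" for i using t(3) that by auto
      have "mono_on {..Suc (Suc n)} t'"
        using t(2) tb \<open>v \<le> w\<close> unfolding mono_on_def t'_def by (auto intro: order_trans[OF tb(2)])
      moreover have "t' ` {..Suc (Suc n)} \<subseteq> {0..w}"
        using tb \<open>v \<le> w\<close> \<open>v \<in> {0..1}\<close> unfolding t'_def by (auto intro: order_trans[OF tb(2)])
      ultimately have "(\<Sum>i<Suc (Suc n). \<bar>f (t' (Suc i)) - f (t' i)\<bar>) \<in> A w"
        unfolding A_def by blast
      then have "(\<Sum>i<Suc (Suc n). \<bar>f (t' (Suc i)) - f (t' i)\<bar>) \<le> T w"
        unfolding T_def using bdd[OF \<open>w \<in> {0..1}\<close>] by (rule cSup_upper)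
      moreover have "(\<Sum>i<n. \<bar>f (t' (Suc i)) - f (t' i)\<bar>) = a"
        unfolding t(1) by (intro sum.cong) (auto simp: t'_def)
      ultimately show ?thesis by (simp add: t'_def)
    qed
    then have "T v \<le> T w - \<bar>f w - f v\<bar>"
      unfolding T_def[of v] using A0[OF \<open>v \<in> {0..1}\<close>] by (intro cSup_least) auto
    then show ?thesis by simp
  qed
  show thesis
  proof (rule that[of "\<lambda>v. T v + K" "\<lambda>v. T v - f v + K"])
    have K0: "K \<ge> 0" using K[of 0] by simp
    show "mono_on {0..1} (\<lambda>v. T v + K)" "mono_on {0..1} (\<lambda>v. T v - f v + K)"
      using step unfolding mono_on_def by (fastforce simp: abs_le_iff)+
    show "0 \<le> T v + K \<and> T v + K \<le> V + 2 * K" "0 \<le> T v - f v + K \<and> T v - f v + K \<le> V + 2 * K"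
      if "v \<in> {0..1}" for v
      using T01[OF that] K[OF that] K0 by auto
  qed simp
qed

section \<open>Empirical distribution functions\<close>

lemma emp_cdf_mono: "mono (emp_cdf n lam x)"
  unfolding mono_def emp_cdf_def by (auto intro!: divide_right_mono sum_mono)

lemma emp_cdf_bounds: "0 \<le> emp_cdf n lam x t" "emp_cdf n lam x t \<le> 1"
proof -
  show "0 \<le> emp_cdf n lam x t"
    unfolding emp_cdf_def by (auto intro!: divide_nonneg_nonneg sum_nonneg)
  have "(\<Sum>j=1..n. if lam (x j) \<le> t then 1 else 0) \<le> (\<Sum>j=1..n. 1 :: real)"
    by (intro sum_mono) auto
  then show "emp_cdf n lam x t \<le> 1"
    \<comment> \<open>For \<open>n = 0\<close> division by zero makes the value 0.\<close>
    unfolding emp_cdf_def by (cases "n = 0") (auto simp: field_simps)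
qed

lemma log_enat_mono: "a \<le> b \<Longrightarrow> log_enat a \<le> log_enat b"
  unfolding log_enat_def by (cases a; cases b) (auto simp: ln_mono)


text \<open>The two monotone parts share \<open>Y\<close> but are bracketed independently, which
  squares the number of brackets. Scaling by \<open>W\<close> reduces each part to values in
  [0,1].\<close>

lemma bracketed_monotone_composition_differences:
  assumes "prob_space P" and X: "distributed P lborel lam p" "\<And>t. p t \<le> ennreal M"
    and "M \<ge> 0" "q \<ge> 1" "real r \<ge> q" and \<epsilon>: "0 < \<epsilon>" "\<epsilon> \<le> 1" and "W > 0"
  shows "bracketed P q (space P) (4 ^ (4 * r * nat \<lceil>1 / \<epsilon>\<rceil>))
    (\<epsilon> powr q * (3 powr q * (2 * (W powr q * (3 powr q * (4 + 3 powr q * (2 powr q * (8 * M) + 1)))))))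
    {\<lambda>x. g (Y x) - h (Y x) | g h Y. mono g \<and> mono h \<and>
       (\<forall>t. 0 \<le> g t \<and> g t \<le> W) \<and> (\<forall>t. 0 \<le> h t \<and> h t \<le> W) \<and>
       (\<forall>x\<in>space P. \<bar>Y x - lam x\<bar> \<le> 2 * \<epsilon> powr q)}"
proof -
  define m where "m = nat \<lceil>1 / \<epsilon>\<rceil>"
  define E where "E = 3 powr q * (4 + 3 powr q * (2 powr q * (8 * M) + 1))"
  have "E \<ge> 0" using \<open>M \<ge> 0\<close> by (simp add: E_def)
  define \<F> where "\<F> = {\<lambda>x. h (Y x) | (h :: real \<Rightarrow> real) Y. mono h \<and> (\<forall>t. 0 \<le> h t \<and> h t \<le> 1) \<and>
       (\<forall>x\<in>space P. \<bar>Y x - lam x\<bar> \<le> 2 * \<epsilon> powr q)}"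
  define \<G> where "\<G> = (\<lambda>f x. 0 + W * f x) ` \<F>"
  have "bracketed P q (space P) (4 ^ (2 * r * m)) (\<epsilon> powr q * E) \<F>"
    unfolding m_def E_def \<F>_def by (rule bracketed_monotone_compositions_radius) fact+
  then have "bracketed P q (space P) (4 ^ (2 * r * m)) (W powr q * (\<epsilon> powr q * E)) \<G>"
    unfolding \<G>_def using \<open>E \<ge> 0\<close> \<open>W > 0\<close> by (intro bracketed_affine) auto
  from bracketed_diff[OF this this]
  have B: "bracketed P q (space P) (4 ^ (2 * r * m) * 4 ^ (2 * r * m))
     (3 powr q * (W powr q * (\<epsilon> powr q * E) + W powr q * (\<epsilon> powr q * E)))
     {\<lambda>x. f x - g x | f g. f \<in> \<G> \<and> g \<in> \<G>}"
    using \<open>E \<ge> 0\<close> \<open>q \<ge> 1\<close> by simp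
  have \<G>: "(\<lambda>x. h (Y x)) \<in> \<G>" if "mono h" "\<And>t. 0 \<le> h t \<and> h t \<le> W"
    "\<forall>x\<in>space P. \<bar>Y x - lam x\<bar> \<le> 2 * \<epsilon> powr q" for h :: "real \<Rightarrow> real" and Y
  proof -
    have "mono (\<lambda>t. h t / W)" "\<And>t. 0 \<le> h t / W \<and> h t / W \<le> 1"
      using that(1,2) \<open>W > 0\<close> by (auto simp: mono_def divide_right_mono)
    with that(3) have "(\<lambda>x. h (Y x) / W) \<in> \<F>"
      unfolding \<F>_def by (auto intro!: exI[of _ "\<lambda>t. h t / W"] exI[of _ Y])
    then have "(\<lambda>x. 0 + W * (h (Y x) / W)) \<in> \<G>" unfolding \<G>_def by (rule imageI)
    then show ?thesis using \<open>W > 0\<close> by simp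
  qed
  show ?thesis
    unfolding m_def[symmetric] E_def[symmetric]
  proof (rule bracketed_mono[OF B])
    show "4 ^ (2 * r * m) * 4 ^ (2 * r * m) \<le> (4 ^ (4 * r * m) :: nat)"
      by (simp flip: power_add)
    fix f assume "f \<in> {\<lambda>x. g (Y x) - h (Y x) | g h Y. mono g \<and> mono h \<and>
       (\<forall>t. 0 \<le> g t \<and> g t \<le> W) \<and> (\<forall>t. 0 \<le> h t \<and> h t \<le> W) \<and>
       (\<forall>x\<in>space P. \<bar>Y x - lam x\<bar> \<le> 2 * \<epsilon> powr q)}"
    then obtain g h Y where f: "f = (\<lambda>x. g (Y x) - h (Y x))" and gh: "mono g" "mono h"
      "\<And>t. 0 \<le> g t \<and> g t \<le> W" "\<And>t. 0 \<le> h t \<and> h t \<le> W"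
      "\<forall>x\<in>space P. \<bar>Y x - lam x\<bar> \<le> 2 * \<epsilon> powr q" by blast
    have "f \<in> {\<lambda>x. f x - g x | f g. f \<in> \<G> \<and> g \<in> \<G>}"
      unfolding f
      by (intro CollectI exI[of _ "\<lambda>x. g (Y x)"] exI[of _ "\<lambda>x. h (Y x)"] conjI refl \<G> gh)
    then show "\<exists>g\<in>{\<lambda>x. f x - g x | f g. f \<in> \<G> \<and> g \<in> \<G>}. \<forall>x\<in>space P. f x = g x" by (intro bexI[of _ f] ballI refl)
  qed (simp add: algebra_simps)
qed

text \<open>The Jordan parts of \<open>\<beta> u\<close> stay monotone after composition with the
  nondecreasing empirical cdf. The bound \<open>W\<close> is the same for all \<open>u\<close>,
  \<open>n\<close> and samples, so these parameters cost no brackets.\<close>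

lemma B_class_element_difference:
  assumes tv: "total_variation 0 1 (\<beta> u) \<le> ennreal V" and K: "\<forall>v\<in>{0..1}. \<bar>\<beta> u v\<bar> \<le> K"
    and W: "\<bar>V\<bar> + 2 * K \<le> W"
  obtains g h where "mono g" "mono h" "\<And>t. 0 \<le> g t \<and> g t \<le> W" "\<And>t. 0 \<le> h t \<and> h t \<le> W"
    "\<And>t. \<beta> u (emp_cdf n lam x t) = g t - h t"
proof -
  \<comment> \<open>The Jordan decomposition wants a nonnegative bound; \<open>ennreal\<close> sends
    a negative \<open>V\<close> to 0.\<close>
  have "total_variation 0 1 (\<beta> u) \<le> ennreal \<bar>V\<bar>"
    using tv by (rule order_trans) (simp add: ennreal_leI)
  then obtain g h where gh: "mono_on {0..1} g" "mono_on {0..1} h"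
    "\<And>v. v \<in> {0..1} \<Longrightarrow> 0 \<le> g v \<and> g v \<le> \<bar>V\<bar> + 2 * K" "\<And>v. v \<in> {0..1} \<Longrightarrow> 0 \<le> h v \<and> h v \<le> \<bar>V\<bar> + 2 * K"
    "\<And>v. v \<in> {0..1} \<Longrightarrow> \<beta> u v = g v - h v"
    using K by (elim total_variation_jordan) auto
  let ?G = "emp_cdf n lam x"
  have G: "?G t \<in> {0..1}" for t using emp_cdf_bounds[of n lam x t] by simp
  show thesis
  proof (rule that[of "\<lambda>t. g (?G t)" "\<lambda>t. h (?G t)"])
    show "mono (\<lambda>t. g (?G t))" "mono (\<lambda>t. h (?G t))"
      using gh(1,2) G monoD[OF emp_cdf_mono[of n lam x]] by (auto intro!: monoI elim!: mono_onD)
    show "0 \<le> g (?G t) \<and> g (?G t) \<le> W" "0 \<le> h (?G t) \<and> h (?G t) \<le> W" for t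
      using gh(3,4)[OF G[of t]] W by auto
    show "\<beta> u (?G t) = g (?G t) - h (?G t)" for t by (rule gh(5)[OF G])
  qed
qed

section \<open>From a sup-norm cover to brackets\<close>

lemma abs_less_if_sup_norm_on_less:
  assumes "sup_norm_on S f < ennreal a" "x \<in> S"
  shows "\<bar>f x\<bar> < a"
proof -
  have "ennreal \<bar>f x\<bar> \<le> sup_norm_on S f"
    unfolding sup_norm_on_def using assms(2) by (rule SUP_upper)
  also note assms(1)
  finally show ?thesis by (simp add: ennreal_less_iff)
qed

text \<open>Each ball of the cover is handled through one representative variable with bounded
  density, and the bracket numbers add up over the balls.\<close>

lemma bracketed_B_class:
  assumes "prob_space P" and dens: "\<forall>lam\<in>\<Lambda>. has_density_bounded_by P M lam"
    and "M \<ge> 0" "q \<ge> 1" "real r \<ge> q" and \<epsilon>: "0 < \<epsilon>" "\<epsilon> \<le> 1"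
    and K: "\<forall>u\<in>{0..1}. \<forall>v\<in>{0..1}. \<bar>\<beta> u v\<bar> \<le> K"
    and tv: "\<forall>u\<in>{0..1}. total_variation 0 1 (\<beta> u) \<le> ennreal V"
    and W: "\<bar>V\<bar> + 2 * K \<le> W" "W > 0"
    and C: "finite C" "\<Lambda> \<subseteq> (\<Union>c\<in>C. {g. sup_norm_on (space P) (\<lambda>x. g x - c x) < ennreal (\<epsilon> powr q)})"
  shows "bracketed P q (space P) (card C * 4 ^ (4 * r * nat \<lceil>1 / \<epsilon>\<rceil>))
    (\<epsilon> powr q * (3 powr q * (2 * (W powr q * (3 powr q * (4 + 3 powr q * (2 powr q * (8 * M) + 1)))))))
    (B_class (space P) \<beta> \<Lambda> n)"
proof -
  define N where "N = (4 :: nat) ^ (4 * r * nat \<lceil>1 / \<epsilon>\<rceil>)"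
  define e where "e = \<epsilon> powr q * (3 powr q * (2 * (W powr q * (3 powr q * (4 + 3 powr q * (2 powr q * (8 * M) + 1))))))"
  \<comment> \<open>The part of \<Lambda> in the ball around \<open>c\<close>. A ball that misses
    \<Lambda> contributes no function.\<close>
  define U where "U c = {lam\<in>\<Lambda>. \<forall>x\<in>space P. \<bar>lam x - c x\<bar> < \<epsilon> powr q}" for c
  define \<G> where "\<G> c = {\<lambda>x. g (Y x) - h (Y x) | g h Y. mono g \<and> mono h \<and>
       (\<forall>t. 0 \<le> g t \<and> g t \<le> W) \<and> (\<forall>t. 0 \<le> h t \<and> h t \<le> W) \<and> Y \<in> U c}" for c
  have "bracketed P q (space P) (\<Sum>c\<in>C. N) e (\<Union>c\<in>C. \<G> c)"
  proof (rule bracketed_UN[OF C(1)])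
    fix c assume "c \<in> C"
    show "bracketed P q (space P) N e (\<G> c)"
    proof (cases "U c = {}")
      case True
      then have "\<G> c = {}" by (simp add: \<G>_def)
      then show ?thesis by (auto simp: bracketed_def intro: exI[of _ "{}"])
    next
      case False
      \<comment> \<open>A centre of the cover may be non-measurable, so a member of \<open>\<Lambda>\<close> replaces it and the radius doubles.\<close>
      then obtain lam where lam: "lam \<in> \<Lambda>" "\<And>x. x \<in> space P \<Longrightarrow> \<bar>lam x - c x\<bar> < \<epsilon> powr q"
        by (auto simp: U_def)
      obtain p where p: "distributed P lborel lam p" "\<And>t. p t \<le> ennreal M"
        using dens lam(1) unfolding has_density_bounded_by_def by blast
      have near: "\<forall>x\<in>space P. \<bar>Y x - lam x\<bar> \<le> 2 * \<epsilon> powr q" if "Y \<in> U c" for Y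
      proof
        fix x assume x: "x \<in> space P"
        with that have "\<bar>Y x - c x\<bar> < \<epsilon> powr q" by (auto simp: U_def)
        with lam(2)[OF x] show "\<bar>Y x - lam x\<bar> \<le> 2 * \<epsilon> powr q" by linarith
      qed
      show ?thesis
        unfolding N_def e_def
      proof (rule bracketed_mono[OF bracketed_monotone_composition_differences[OF assms(1) p assms(3-7) W(2)] order.refl order.refl])
        fix f assume "f \<in> \<G> c"
        then have "f \<in> {\<lambda>x. g (Y x) - h (Y x) | g h Y. mono g \<and> mono h \<and>
         (\<forall>t. 0 \<le> g t \<and> g t \<le> W) \<and> (\<forall>t. 0 \<le> h t \<and> h t \<le> W) \<and>
         (\<forall>x\<in>space P. \<bar>Y x - lam x\<bar> \<le> 2 * \<epsilon> powr q)}"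
          unfolding \<G>_def using near by blast
        then show "\<exists>g\<in>{\<lambda>x. g (Y x) - h (Y x) | g h Y. mono g \<and> mono h \<and>
         (\<forall>t. 0 \<le> g t \<and> g t \<le> W) \<and> (\<forall>t. 0 \<le> h t \<and> h t \<le> W) \<and>
         (\<forall>x\<in>space P. \<bar>Y x - lam x\<bar> \<le> 2 * \<epsilon> powr q)}. \<forall>x\<in>space P. f x = g x"
          by (intro bexI[of _ f] ballI refl)
      qed
    qed
  qed
  then show ?thesis
    unfolding N_def[symmetric] e_def[symmetric]
  proof (rule bracketed_mono)
    fix f assume "f \<in> B_class (space P) \<beta> \<Lambda> n"
    then obtain u lam x where f: "f = (\<lambda>y. \<beta> u (emp_cdf n lam x (lam y)))" "u \<in> {0..1}" "lam \<in> \<Lambda>"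
      unfolding B_class_def by blast
    obtain c where c: "c \<in> C" "sup_norm_on (space P) (\<lambda>x. lam x - c x) < ennreal (\<epsilon> powr q)"
      using C(2) f(3) by blast
    have "lam \<in> U c"
      unfolding U_def using f(3) abs_less_if_sup_norm_on_less[OF c(2)] by auto
    obtain g h where gh: "mono g" "mono h" "\<And>t. 0 \<le> g t \<and> g t \<le> W" "\<And>t. 0 \<le> h t \<and> h t \<le> W"
      "\<And>t. \<beta> u (emp_cdf n lam x t) = g t - h t"
      using B_class_element_difference[where \<beta> = \<beta> and u = u and n = n and lam = lam and x = x,
        OF tv[rule_format, OF f(2)] K[THEN bspec, OF f(2)] W(1)] by metis
    have "f \<in> \<G> c"
      unfolding f(1) gh(5) \<G>_def
      by (intro CollectI exI[of _ g] exI[of _ h] exI[of _ lam] conjI allI refl)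
        (use gh(1-4) \<open>lam \<in> U c\<close> in auto)
    with c(1) have "f \<in> (\<Union>c\<in>C. \<G> c)" by blast
    then show "\<exists>g\<in>\<Union>c\<in>C. \<G> c. \<forall>x\<in>space P. f x = g x" by (intro bexI[of _ f] ballI refl)
  qed simp_all
qed

text \<open>A nonempty set of \<open>enat\<close> values contains its infimum, so a finite covering
  number is attained by an actual cover.\<close>

lemma covering_numberE:
  assumes "covering_number nrm \<epsilon> F \<noteq> \<infinity>"
  obtains C where "finite C" "covering_number nrm \<epsilon> F = enat (card C)"
    "F \<subseteq> (\<Union>c\<in>C. {g. nrm (\<lambda>x. g x - c x) < ennreal \<epsilon>})"
proof -
  let ?S = "{enat (card C) | C. finite C \<and> (\<forall>c\<in>C. nrm c < \<infinity>) \<and>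
     F \<subseteq> (\<Union>c\<in>C. {g. nrm (\<lambda>x. g x - c x) < ennreal \<epsilon>})}"
  have "?S \<noteq> {}" using assms unfolding covering_number_def Inf_enat_def by (auto split: if_splits)
  then have "covering_number nrm \<epsilon> F \<in> ?S"
    unfolding covering_number_def Inf_enat_def by (metis (mono_tags, lifting) LeastI ex_in_conv)
  then show thesis using that by blast
qed

theorem corollaryA1:
  fixes q M :: real
  assumes "q \<ge> 1" and "M > 0"
  shows "\<exists>C1>0. \<forall>K V :: real. \<exists>C2>0.
    \<forall>(d :: nat) (P :: (nat \<Rightarrow> real) measure) (\<Lambda> :: ((nat \<Rightarrow> real) \<Rightarrow> real) set)
      (\<beta> :: real \<Rightarrow> real \<Rightarrow> real) (n :: nat) (\<epsilon> :: real).
      d \<ge> 1 \<longrightarrow> prob_space P \<longrightarrow> sets P = sets (euclid d) \<longrightarrow>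
      (\<forall>lam\<in>\<Lambda>. lam \<in> borel_measurable (euclid d) \<and> has_density_bounded_by P M lam) \<longrightarrow>
      (\<forall>u\<in>{0..1}. \<forall>v\<in>{0..1}. \<bar>\<beta> u v\<bar> \<le> K) \<longrightarrow>
      (\<forall>u\<in>{0..1}. total_variation 0 1 (\<beta> u) \<le> ennreal V) \<longrightarrow>
      n \<ge> 1 \<longrightarrow> \<epsilon> > 0 \<longrightarrow>
      log_enat (bracketing_number P q (C2 * \<epsilon>) (B_class (space (euclid d)) \<beta> \<Lambda> n))
        \<le> log_enat (covering_number (sup_norm_on (space (euclid d))) (\<epsilon> powr q) \<Lambda>)
          + ereal (C1 / \<epsilon>)"
proof -
  define r where "r = nat \<lceil>q\<rceil>"
  have r: "real r \<ge> q" "r \<ge> 1" unfolding r_def using \<open>q \<ge> 1\<close> by linarith+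
  \<comment> \<open>The bracket count for \<epsilon> at most 1 has the factor
    \<open>4 ^ (4 * r * m)\<close> with \<open>m \<le> 2 / \<epsilon>\<close>. Thus
    \<open>C1\<close> depends on \<open>q\<close> only.\<close>
  define C1 where "C1 = 8 * real r * ln 4"
  have "C1 > 0" using r(2) by (simp add: C1_def)
  show ?thesis
  proof (rule exI[of _ C1], intro conjI allI \<open>C1 > 0\<close>)
    fix K V :: real
    \<comment> \<open>The summand 1 gives \<open>W > 0\<close> for arbitrary reals \<open>K\<close>
      and \<open>V\<close>.\<close>
    define W where "W = \<bar>V\<bar> + 2 * \<bar>K\<bar> + 1"
    define E where "E = 3 powr q * (2 * (W powr q * (3 powr q * (4 + 3 powr q * (2 powr q * (8 * M) + 1)))))"
    have "E \<ge> 0" using \<open>M > 0\<close> by (simp add: E_def)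
    \<comment> \<open>The first summand serves \<epsilon> at most 1, the second serves \<epsilon>
      above 1, where a single bracket of height \<open>2 * \<bar>K\<bar>\<close> is used; the third
      makes the size bounds strict. Scaling \<beta> scales the brackets, so \<open>C2\<close> is
      chosen after \<open>K\<close> and \<open>V\<close>.\<close>
    define C2 where "C2 = E powr (1 / q) + 2 * \<bar>K\<bar> + 1"
    have "C2 > 0" unfolding C2_def by (simp add: add_nonneg_pos)
    show "\<exists>C2>0. \<forall>(d :: nat) (P :: (nat \<Rightarrow> real) measure) (\<Lambda> :: ((nat \<Rightarrow> real) \<Rightarrow> real) set)
      (\<beta> :: real \<Rightarrow> real \<Rightarrow> real) (n :: nat) (\<epsilon> :: real).
      d \<ge> 1 \<longrightarrow> prob_space P \<longrightarrow> sets P = sets (euclid d) \<longrightarrow>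
      (\<forall>lam\<in>\<Lambda>. lam \<in> borel_measurable (euclid d) \<and> has_density_bounded_by P M lam) \<longrightarrow>
      (\<forall>u\<in>{0..1}. \<forall>v\<in>{0..1}. \<bar>\<beta> u v\<bar> \<le> K) \<longrightarrow>
      (\<forall>u\<in>{0..1}. total_variation 0 1 (\<beta> u) \<le> ennreal V) \<longrightarrow>
      n \<ge> 1 \<longrightarrow> \<epsilon> > 0 \<longrightarrow>
      log_enat (bracketing_number P q (C2 * \<epsilon>) (B_class (space (euclid d)) \<beta> \<Lambda> n))
        \<le> log_enat (covering_number (sup_norm_on (space (euclid d))) (\<epsilon> powr q) \<Lambda>)
          + ereal (C1 / \<epsilon>)"
    proof (rule exI[of _ C2], intro conjI allI impI \<open>C2 > 0\<close>)
      fix d n :: nat and P :: "(nat \<Rightarrow> real) measure" and \<Lambda> :: "((nat \<Rightarrow> real) \<Rightarrow> real) set"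
        and \<beta> :: "real \<Rightarrow> real \<Rightarrow> real" and \<epsilon> :: real
      assume "prob_space P" and sets: "sets P = sets (euclid d)"
        and \<Lambda>: "\<forall>lam\<in>\<Lambda>. lam \<in> borel_measurable (euclid d) \<and> has_density_bounded_by P M lam"
        and K: "\<forall>u\<in>{0..1}. \<forall>v\<in>{0..1}. \<bar>\<beta> u v\<bar> \<le> K"
        and tv: "\<forall>u\<in>{0..1}. total_variation 0 1 (\<beta> u) \<le> ennreal V" and "\<epsilon> > 0"
      interpret prob_space P by fact
      have space: "space (euclid d) = space P" using sets_eq_imp_space_eq[OF sets] by simp
      let ?B = "B_class (space P) \<beta> \<Lambda> n"
      let ?N = "covering_number (sup_norm_on (space P)) (\<epsilon> powr q) \<Lambda>"
      have "log_enat (bracketing_number P q (C2 * \<epsilon>) ?B) \<le> log_enat ?N + ereal (C1 / \<epsilon>)"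
      proof (cases "?N = \<infinity>")
        case True
        then show ?thesis by (simp add: log_enat_def)
      next
        case False
        then obtain C where C: "finite C" "?N = enat (card C)"
          "\<Lambda> \<subseteq> (\<Union>c\<in>C. {g. sup_norm_on (space P) (\<lambda>x. g x - c x) < ennreal (\<epsilon> powr q)})"
          by (rule covering_numberE)
        obtain k where k: "k > 0" "ln (real k) \<le> C1 / \<epsilon>"
          "bracketing_number P q (C2 * \<epsilon>) ?B \<le> enat (card C * k)"
        proof (cases "\<epsilon> \<le> 1")
          case True
          define m where "m = nat \<lceil>1 / \<epsilon>\<rceil>"
          have "1 / \<epsilon> \<ge> 1" using True \<open>\<epsilon> > 0\<close> by simp
          then have m: "real m \<le> 2 / \<epsilon>" unfolding m_def by linarith
          have "bracketed P q (space P) (card C * 4 ^ (4 * r * m)) (\<epsilon> powr q * E) ?B"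
            unfolding m_def E_def
            by (rule bracketed_B_class[OF \<open>prob_space P\<close> _ _ \<open>q \<ge> 1\<close> r(1) \<open>\<epsilon> > 0\<close> True K tv _ _ C(1,3)])
              (use \<Lambda> \<open>M > 0\<close> in \<open>auto simp: W_def\<close>)
          moreover have "(\<epsilon> powr q * E) powr (1 / q) < C2 * \<epsilon>"
          proof -
            have "(\<epsilon> powr q * E) powr (1 / q) = \<epsilon> * E powr (1 / q)"
              using \<open>\<epsilon> > 0\<close> \<open>E \<ge> 0\<close> \<open>q \<ge> 1\<close> by (simp add: powr_mult powr_powr)
            also have "\<dots> < \<epsilon> * C2"
              using \<open>\<epsilon> > 0\<close> by (intro mult_strict_left_mono) (auto simp: C2_def)
            finally show ?thesis by (simp add: mult.commute)
          qed
          ultimately have "bracketing_number P q (C2 * \<epsilon>) ?B \<le> enat (card C * 4 ^ (4 * r * m))"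
            using \<open>q \<ge> 1\<close> \<open>E \<ge> 0\<close> by (intro bracketing_number_le_if_bracketed[OF _ \<open>prob_space P\<close>]) auto
          moreover have "ln (real (4 ^ (4 * r * m))) \<le> C1 / \<epsilon>"
          proof -
            have "ln (real (4 ^ (4 * r * m))) = 4 * real r * ln 4 * real m"
              by (simp add: ln_realpow)
            also have "\<dots> \<le> 4 * real r * ln 4 * (2 / \<epsilon>)"
              using m by (intro mult_left_mono) auto
            finally show ?thesis by (simp add: C1_def)
          qed
          ultimately show thesis by (intro that[of "4 ^ (4 * r * m)"]) auto
        next
          case False
          have sub: "bracketing_number P q (C2 * \<epsilon>) ?B \<le> enat (card C * 1)"
          \<comment> \<open>An empty cover has logarithm \<open>-\<infinity>\<close>, so the
            bracketing number must be exactly 0; \<Lambda> and the class are then empty. Otherwise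
            one bracket is within the allowance \<open>card C\<close>.\<close>
          proof (cases "card C = 0")
            case True
            then have "?B = {}" using C(1,3) by (auto simp: B_class_def)
            then have "bracketed P q (space P) (card C * 1) 0 ?B"
              by (auto simp: bracketed_def intro: exI[of _ "{}"])
            then show ?thesis
              using \<open>q \<ge> 1\<close> \<open>C2 > 0\<close> \<open>\<epsilon> > 0\<close>
              by (intro bracketing_number_le_if_bracketed[OF _ \<open>prob_space P\<close>]) auto
          next
            case card: False
            have "bracketed P q (space P) 1 (1 * (\<bar>K\<bar> - (- \<bar>K\<bar>)) powr q) {f. \<forall>x\<in>space P. - \<bar>K\<bar> \<le> f x \<and> f x \<le> \<bar>K\<bar>}"
              by (rule bracketed_trivial) (auto simp: emeasure_space_1)
            then have "bracketed P q (space P) (card C * 1) ((2 * \<bar>K\<bar>) powr q) ?B"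
            proof (rule bracketed_mono)
              fix f assume "f \<in> ?B"
              then obtain u lam x where f: "f = (\<lambda>y. \<beta> u (emp_cdf n lam x (lam y)))" "u \<in> {0..1}"
                unfolding B_class_def by blast
              have "\<bar>f y\<bar> \<le> \<bar>K\<bar>" for y
                using K[THEN bspec, OF f(2), THEN bspec, of "emp_cdf n lam x (lam y)"]
                  emp_cdf_bounds[of n lam x "lam y"] unfolding f(1) by auto
              then have "f \<in> {f. \<forall>x\<in>space P. - \<bar>K\<bar> \<le> f x \<and> f x \<le> \<bar>K\<bar>}"
                by (auto simp: abs_le_iff minus_le_iff)
              then show "\<exists>g\<in>{f. \<forall>x\<in>space P. - \<bar>K\<bar> \<le> f x \<and> f x \<le> \<bar>K\<bar>}. \<forall>x\<in>space P. f x = g x" by (intro bexI[of _ f] ballI refl)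
            qed (use card in auto)
            moreover have "((2 * \<bar>K\<bar>) powr q) powr (1 / q) < C2 * \<epsilon>"
            proof -
              have "((2 * \<bar>K\<bar>) powr q) powr (1 / q) = 2 * \<bar>K\<bar>"
                using \<open>q \<ge> 1\<close> by (simp add: powr_powr)
              also have "\<dots> < C2 * 1" by (simp add: C2_def add_nonneg_pos)
              also have "\<dots> \<le> C2 * \<epsilon>" using False \<open>C2 > 0\<close> by (intro mult_left_mono) auto
              finally show ?thesis .
            qed
            ultimately show ?thesis
              using \<open>q \<ge> 1\<close> by (intro bracketing_number_le_if_bracketed[OF _ \<open>prob_space P\<close>]) auto
          qed
          show thesis
            by (rule that[OF _ _ sub]) (use \<open>C1 > 0\<close> \<open>\<epsilon> > 0\<close> in auto)
        qed
        have "log_enat (bracketing_number P q (C2 * \<epsilon>) ?B) \<le> log_enat (enat (card C * k))"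
          using k(3) by (rule log_enat_mono)
        also have "\<dots> \<le> log_enat ?N + ereal (C1 / \<epsilon>)"
          using k(1,2) unfolding C(2) by (cases "card C = 0") (auto simp: log_enat_def ln_mult)
        finally show ?thesis .
      qed
      then show "log_enat (bracketing_number P q (C2 * \<epsilon>) (B_class (space (euclid d)) \<beta> \<Lambda> n))
        \<le> log_enat (covering_number (sup_norm_on (space (euclid d))) (\<epsilon> powr q) \<Lambda>) + ereal (C1 / \<epsilon>)"
        unfolding space .
    qed
  qed
qed

end
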